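(* Let $F=\{\sigma_1,\dots,\sigma_n\}\subset\partial\mathbb{D}$ consist of pairwise distinct points, let $\Lambda=(\lambda_1,\dots,\lambda_n)\in(-\infty,0)^n$, and let $\tau\in\partial\mathbb{D}\setminus F$. Put $\alpha_k:=|\tau-\sigma_k|^2/(2|\lambda_k|)$, $$Z:=\Big\{\zeta:\Big|\Big(2\tau^{-1}\sum_k\alpha_k\Big)\zeta-1\Big|\le1\Big\},\qquad \ell_\zeta:=\tau/\zeta-\sum_k\alpha_k\ \ (\zeta\ne0).$$ Then $$W_\tau(F,\Lambda):=\{(G(0),\beta(G)):G\in\mathsf{Gen}_\tau(F,\Lambda)\setminus\{G\equiv0\}\}=\{(\zeta,b):\zeta\in Z\setminus\{0\},\ 0\le b\le2\,\mathrm{Re}\,\ell_\zeta\}.$$ Moreover, for each $\zeta\in Z\setminus\{0\}$ there is a unique $G\in\mathsf{Gen}_\tau(F,\Lambda)$ with $G(0)=\zeta$ and $\beta(G)=2\,\mathrm{Re}\,\ell_\zeta$, namely $$G(z)=\frac{(\tau-z)(1-\overline\tau z)}{\frac{\tau+z}{\tau-z}\mathrm{Re}\,\ell_\zeta+i\,\mathrm{Im}\,\ell_\zeta+p_0(z;F,\Lambda)}.$$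
   Context: $\mathbb{D}$ is the open unit disk. A one-parameter semigroup $(\phi_t)_{t\ge0}$ of holomorphic self-maps of $\mathbb{D}$ satisfies $\phi_0=\mathrm{id}$, $\phi_s\circ\phi_t=\phi_{s+t}$, and $\phi_t\to\mathrm{id}$ pointwise as $t\to 0^+$. Its infinitesimal generator $G$ satisfies $\frac{d}{dt}\phi_t(z)=G(\phi_t(z))$. $\mathsf{Gen}_\tau$ is the set of generators with Denjoy–Wolff point $\tau$, together with $G\equiv0$. For $\tau\in\partial\mathbb{D}$ and $G\in\mathsf{Gen}_\tau\setminus\{0\}$, the angular limit $$\beta(G):=\angle\lim_{z\to\tau}\frac{(\tau-z)^3}{\tau^2G(z)}$$ exists and belongs to $[0,+\infty)$. A point $\sigma\in\partial\mathbb{D}$ is a boundary regular fixed point (BRFP) if each $\phi_t$ has angular limit $\sigma$ and a finite angular derivative at $\sigma$. The spectral value there is $\lambda'$ with $\phi_t'(\sigma)=e^{-\lambda't}$, equivalently $\lambda'=\angle\lim_{z\to\sigma}G(z)/(\sigma-z)$. $\mathsf{Gen}_\tau(F,\Lambda)$ is the set of $G\in\mathsf{Gen}_\tau$ whose semigroup has BRFPs at all $\sigma_k$ with spectral values $\lambda'_k\in[\lambda_k,0]$ (including $G\equiv0$). $p_0(z;F,\Lambda):=\sum_k\alpha_k\frac{\sigma_k+z}{\sigma_k-z}$. *)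

theory Defs
  imports "HOL-Analysis.Analysis"
begin

abbreviation unit_disc :: "complex set" where
  "unit_disc \<equiv> ball 0 1"

definition angular_limit :: "(complex \<Rightarrow> complex) \<Rightarrow> complex \<Rightarrow> complex \<Rightarrow> bool" where
  "angular_limit f \<sigma> L \<longleftrightarrow>
     (\<forall>M>1. (f \<longlongrightarrow> L) (at \<sigma> within {z \<in> unit_disc. cmod (\<sigma> - z) < M * (1 - cmod z)}))"

definition is_semigroup :: "(real \<Rightarrow> complex \<Rightarrow> complex) \<Rightarrow> bool" where
  "is_semigroup \<phi> \<longleftrightarrow>
     (\<forall>t\<ge>0. \<phi> t holomorphic_on unit_disc \<and> \<phi> t ` unit_disc \<subseteq> unit_disc) \<and>
     (\<forall>z\<in>unit_disc. \<phi> 0 z = z) \<and>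
     (\<forall>s\<ge>0. \<forall>t\<ge>0. \<forall>z\<in>unit_disc. \<phi> s (\<phi> t z) = \<phi> (s + t) z) \<and>
     (\<forall>z\<in>unit_disc. ((\<lambda>t. \<phi> t z) \<longlongrightarrow> z) (at_right 0))"

definition is_generator_of :: "(complex \<Rightarrow> complex) \<Rightarrow> (real \<Rightarrow> complex \<Rightarrow> complex) \<Rightarrow> bool" where
  "is_generator_of G \<phi> \<longleftrightarrow>
     G holomorphic_on unit_disc \<and>
     (\<forall>z\<in>unit_disc. \<forall>t\<ge>0.
        ((\<lambda>s. \<phi> s z) has_vector_derivative G (\<phi> t z)) (at t within {0..}))"

definition boundary_DW_point :: "(real \<Rightarrow> complex \<Rightarrow> complex) \<Rightarrow> complex \<Rightarrow> bool" where
  "boundary_DW_point \<phi> \<tau> \<longleftrightarrow> (\<forall>z\<in>unit_disc. ((\<lambda>t. \<phi> t z) \<longlongrightarrow> \<tau>) at_top)"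

definition Gen :: "complex \<Rightarrow> (complex \<Rightarrow> complex) set" where
  "Gen \<tau> = {G. (\<forall>z\<in>unit_disc. G z = 0) \<or>
                 (\<exists>\<phi>. is_semigroup \<phi> \<and> is_generator_of G \<phi> \<and> boundary_DW_point \<phi> \<tau>)}"

definition BRFP_spectral :: "(real \<Rightarrow> complex \<Rightarrow> complex) \<Rightarrow> complex \<Rightarrow> real \<Rightarrow> bool" where
  "BRFP_spectral \<phi> \<sigma> \<mu> \<longleftrightarrow>
     (\<forall>t\<ge>0. angular_limit (\<phi> t) \<sigma> \<sigma> \<and>
            angular_limit (\<lambda>z. (\<phi> t z - \<sigma>) / (z - \<sigma>)) \<sigma> (complex_of_real (exp (- \<mu> * t))))"

definition Gen_FL :: "complex \<Rightarrow> nat \<Rightarrow> (nat \<Rightarrow> complex) \<Rightarrow> (nat \<Rightarrow> real) \<Rightarrow> (complex \<Rightarrow> complex) set" where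
  "Gen_FL \<tau> n \<sigma> \<Lambda> = {G. (\<forall>z\<in>unit_disc. G z = 0) \<or>
      (\<exists>\<phi>. is_semigroup \<phi> \<and> is_generator_of G \<phi> \<and> boundary_DW_point \<phi> \<tau> \<and>
           (\<forall>k<n. \<exists>\<mu>. \<Lambda> k \<le> \<mu> \<and> \<mu> \<le> 0 \<and> BRFP_spectral \<phi> (\<sigma> k) \<mu>))}"

definition beta :: "complex \<Rightarrow> (complex \<Rightarrow> complex) \<Rightarrow> complex" where
  "beta \<tau> G = (THE L. angular_limit (\<lambda>z. (\<tau> - z) ^ 3 / (\<tau> ^ 2 * G z)) \<tau> L)"

definition p0 :: "nat \<Rightarrow> (nat \<Rightarrow> complex) \<Rightarrow> (nat \<Rightarrow> real) \<Rightarrow> complex \<Rightarrow> complex" where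
  "p0 n \<sigma> \<alpha> z = (\<Sum>k<n. complex_of_real (\<alpha> k) * (\<sigma> k + z) / (\<sigma> k - z))"

end

theory Submission
  imports Defs "HOL-Complex_Analysis.Riemann_Mapping"
begin

text \<open>
  Write a generator as \<open>G z = (\<tau> - z) * (1 - cnj \<tau> * z) / p z\<close> with \<open>Re p \<ge> 0\<close>. Fixed points on the
  boundary become atoms of \<open>p\<close>: the function \<open>p\<close> has at \<open>\<sigma>\<^sub>k\<close> an atom of mass at least \<open>\<alpha>\<^sub>k\<close> if and
  only if \<open>\<sigma>\<^sub>k\<close> is a fixed point with spectral value in \<open>[\<lambda>\<^sub>k, 0]\<close>, and \<open>\<beta>(G)\<close> is twice the mass at
  \<open>\<tau>\<close>. Subtracting all these atoms leaves a function with nonnegative real part, whose value at \<open>0\<close>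
  is \<open>\<ell>\<^sub>\<zeta> - \<beta>(G) / 2\<close>. This gives the inequality \<open>\<beta>(G) \<le> 2 Re \<ell>\<^sub>\<zeta>\<close>, and in the case of equality the
  remainder is an imaginary constant. The atoms are handled by the Pick inequality alone.

  Conversely, in the right half-plane with \<open>\<tau>\<close> sent to infinity the equation reads \<open>w' = 2 / p\<close>, and a
  primitive of \<open>p / 2\<close> is univalent and linearizes the flow.
\<close>

section \<open>The Pick inequality\<close>

text \<open>The constants come from evaluation. Every \<open>cay s\<close> is 1 at 0 and the
  denominator of G satisfies \<open>p 0 = \<tau> / G 0\<close>, so removing atoms from p subtracts
  their masses from \<tau>/\<zeta>; with the masses \<open>\<alpha> k\<close> removed,
  \<open>ell\<close> is left. A spectral value \<mu> at \<sigma> and the mass m of p there are tied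
  by 2 * \<mu> * m = -|\<tau> - \<sigma>|^2, which makes \<open>\<alpha> k\<close> the mass that
  belongs to \<open>\<Lambda> k\<close>. The obstacle in the converse is that a generator is defined
  through its semigroup: a formula for G is not enough. The flow has to be built for all times, and
  every time-t map needs an angular derivative at each \<sigma>. In the half-plane real parts grow
  along trajectories, so finite-time escape could only be to infinity, which a Harnack bound on Re p
  excludes. The derivatives come from Gronwall estimates for the distance of the orbit to
  \<sigma>.\<close>

definition cay :: "complex \<Rightarrow> complex \<Rightarrow> complex" where
  "cay \<sigma> z = (\<sigma> + z) / (\<sigma> - z)"

lemma cnj_unit: "cmod \<sigma> = 1 \<Longrightarrow> \<sigma> * cnj \<sigma> = 1"
  by (simp add: complex_norm_square [symmetric])

lemma unit_disc_ne: "cmod \<sigma> = 1 \<Longrightarrow> z \<in> unit_disc \<Longrightarrow> \<sigma> - z \<noteq> 0"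
  by auto

text \<open>The polarized form of the Poisson kernel. Equal arguments give \<open>Re_cay\<close>;
  different ones make the Pick inequality explicit in \<open>wolff\<close>.\<close>

lemma cay_add_cnj:
  assumes "cmod \<sigma> = 1" "z \<noteq> \<sigma>" "w \<noteq> \<sigma>"
  shows "cay \<sigma> z + cnj (cay \<sigma> w) = 2 * (1 - z * cnj w) / ((\<sigma> - z) * cnj (\<sigma> - w))"
proof -
  have "\<sigma> * cnj \<sigma> = 1" using assms cnj_unit by auto
  then have "(\<sigma> + z) * cnj (\<sigma> - w) + cnj (\<sigma> + w) * (\<sigma> - z) = 2 * (1 - z * cnj w)"
    by (simp add: algebra_simps)
  moreover have "\<sigma> - z \<noteq> 0" "cnj (\<sigma> - w) \<noteq> 0" using assms by auto
  ultimately show ?thesis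
    unfolding cay_def complex_cnj_divide by (subst add_frac_eq) (auto simp: mult.commute)
qed

lemma Re_cay:
  assumes "cmod \<sigma> = 1" "z \<noteq> \<sigma>"
  shows "Re (cay \<sigma> z) = (1 - (cmod z)\<^sup>2) / (cmod (\<sigma> - z))\<^sup>2"
proof -
  have "complex_of_real (2 * Re (cay \<sigma> z)) = 2 * (1 - z * cnj z) / ((\<sigma> - z) * cnj (\<sigma> - z))"
    using cay_add_cnj[OF assms(1) assms(2) assms(2)] by (simp only: complex_add_cnj)
  also have "\<dots> = complex_of_real (2 * ((1 - (cmod z)\<^sup>2) / (cmod (\<sigma> - z))\<^sup>2))"
    by (simp only: complex_norm_square [symmetric]) simp
  finally show ?thesis
    by (simp only: of_real_eq_iff)
qed

lemma unit_disc_sq_lt: "z \<in> unit_disc \<Longrightarrow> 0 < 1 - (cmod z)\<^sup>2"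
  by (simp add: power_less_one_iff abs_square_less_1)

lemma Re_cay_pos:
  assumes "cmod \<sigma> = 1" "z \<in> unit_disc"
  shows "Re (cay \<sigma> z) > 0"
  using assms unit_disc_sq_lt[OF assms(2)] unit_disc_ne[OF assms] by (subst Re_cay) auto

lemma mult_cay: "z \<noteq> \<sigma> \<Longrightarrow> (\<sigma> - z) * cay \<sigma> z = \<sigma> + z"
  by (simp add: cay_def)

lemma cay_0 [simp]: "cmod \<sigma> = 1 \<Longrightarrow> cay \<sigma> 0 = 1"
  by (auto simp: cay_def)

lemma holomorphic_cay: "cmod \<sigma> = 1 \<Longrightarrow> cay \<sigma> holomorphic_on unit_disc"
  unfolding cay_def by (intro holomorphic_intros) auto

text \<open>This and \<open>cmod_add_cnj_sq\<close> compute one minus the squared pseudohyperbolic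
  distance, in the disc and in the half-plane, cleared of denominators. They turn Schwarz's lemma
  into the Pick inequality.\<close>

lemma cmod_diff_sq: "(cmod (1 - cnj a * z))\<^sup>2 - (cmod (z - a))\<^sup>2 = (1 - (cmod z)\<^sup>2) * (1 - (cmod a)\<^sup>2)"
  unfolding cmod_power2 by (simp add: algebra_simps power2_eq_square)

lemma cmod_add_cnj_sq: "(cmod (a + cnj b))\<^sup>2 - (cmod (a - b))\<^sup>2 = 4 * Re a * Re b"
  unfolding cmod_power2 by (simp add: algebra_simps power2_eq_square)

text \<open>Conjugation inverts unit numbers, so |\<tau> - \<sigma>|^2 = (\<tau> -
  \<sigma>)(1/\<tau> - 1/\<sigma>) = -(\<tau> - \<sigma>)^2/(\<tau>\<sigma>). Because of this,
  limits of G z / (\<sigma> - z) at the fixed points come out real.\<close>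

lemma diff_sq_eq:
  assumes "cmod \<tau> = 1" "cmod \<sigma> = 1"
  shows "cnj \<tau> * (\<tau> - \<sigma>)\<^sup>2 = - \<sigma> * of_real ((cmod (\<tau> - \<sigma>))\<^sup>2)"
  unfolding complex_norm_square using cnj_unit[OF assms(1)] cnj_unit[OF assms(2)]
  apply (simp add: power2_eq_square) by algebra

text \<open>Schwarz's lemma for p, moved by a disc automorphism and a Cayley map so that 0 goes to
  0. The product form stays meaningful when real parts tend to 0, as \<open>pick\<close>
  requires.\<close>

lemma pick_pos:
  assumes p: "p holomorphic_on unit_disc" "\<And>z. z \<in> unit_disc \<Longrightarrow> Re (p z) > 0"
    and z: "z \<in> unit_disc" and a: "a \<in> unit_disc"
  shows "(1 - (cmod z)\<^sup>2) * (1 - (cmod a)\<^sup>2) * (cmod (p z + cnj (p a)))\<^sup>2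
         \<le> 4 * Re (p z) * Re (p a) * (cmod (1 - cnj a * z))\<^sup>2"
proof -
  define M where "M = Moebius_function 0 (-a)"
  \<comment> \<open>\<open>M\<close> sends 0 to \<open>a\<close>, and the quotient maps the right
    half-plane into the disc with \<open>p a\<close> going to 0.\<close>
  define g where "g = (\<lambda>\<xi>. (p (M \<xi>) - p a) / (p (M \<xi>) + cnj (p a)))"
  define w where "w = Moebius_function 0 a z"
  have a1: "cmod a < 1" and z1: "cmod z < 1" using a z by auto
  have Mball: "M \<xi> \<in> unit_disc" if "cmod \<xi> < 1" for \<xi>
    using Moebius_function_norm_lt_1[of "-a" \<xi> 0] a1 that by (auto simp: M_def)
  have ne: "p x + cnj (p a) \<noteq> 0" if "x \<in> unit_disc" for x
  proof
    assume "p x + cnj (p a) = 0"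
    then have "Re (p x) + Re (p a) = 0" by (metis complex_cnj(1) cnj.sel(1) plus_complex.sel(1) zero_complex.sel(1))
    then show False using p(2)[OF that] p(2)[OF a] by linarith
  qed
  have holM: "M holomorphic_on unit_disc"
    unfolding M_def using a1 by (intro Moebius_function_holomorphic) auto
  have holpM: "(\<lambda>\<xi>. p (M \<xi>)) holomorphic_on unit_disc"
    using holomorphic_on_compose_gen[OF holM p(1)] Mball by (auto simp: o_def image_subset_iff)
  have "g holomorphic_on ball 0 1"
    unfolding g_def by (intro holomorphic_intros holpM) (use ne Mball in auto)
  moreover have "g 0 = 0"
    by (simp add: g_def M_def Moebius_function_of_zero)
  moreover have "cmod (g \<xi>) < 1" if "cmod \<xi> < 1" for \<xi>
  proof -
    have "Re (p (M \<xi>)) * Re (p a) > 0"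
      using p(2)[OF Mball[OF that]] p(2)[OF a] by simp
    then have "(cmod (p (M \<xi>) - p a))\<^sup>2 < (cmod (p (M \<xi>) + cnj (p a)))\<^sup>2"
      using cmod_add_cnj_sq[of "p (M \<xi>)" "p a"] by linarith
    then have "cmod (p (M \<xi>) - p a) < cmod (p (M \<xi>) + cnj (p a))"
      by (rule power_less_imp_less_base) auto
    then show ?thesis
      by (simp add: g_def norm_divide divide_less_eq_1)
  qed
  moreover have "cmod w < 1"
    unfolding w_def by (rule Moebius_function_norm_lt_1) (use a1 z1 in auto)
  ultimately have "cmod (g w) \<le> cmod w"
    by (rule Schwarz_Lemma(1))
  moreover have "M w = z"
    unfolding M_def w_def by (rule Moebius_function_compose) (use a1 z1 in auto)
  ultimately have *: "cmod (p z - p a) / cmod (p z + cnj (p a)) \<le> cmod (z - a) / cmod (1 - cnj a * z)"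
    by (simp add: g_def w_def Moebius_function_simple norm_divide)
  have "cmod (cnj a * z) < 1"
    using a1 z1 by (metis complex_mod_cnj norm_mult_less mult_1)
  then have d: "cmod (1 - cnj a * z) > 0" by auto
  have d': "cmod (p z + cnj (p a)) > 0" using ne[OF z] by simp
  have "cmod (p z - p a) * cmod (1 - cnj a * z) \<le> cmod (z - a) * cmod (p z + cnj (p a))"
    using * d d' by (simp add: field_simps)
  then have "(cmod (p z - p a) * cmod (1 - cnj a * z))\<^sup>2 \<le> (cmod (z - a) * cmod (p z + cnj (p a)))\<^sup>2"
    by (intro power_mono) auto
  then have "((cmod (p z + cnj (p a)))\<^sup>2 - 4 * Re (p z) * Re (p a)) * (cmod (1 - cnj a * z))\<^sup>2
     \<le> ((cmod (1 - cnj a * z))\<^sup>2 - (1 - (cmod z)\<^sup>2) * (1 - (cmod a)\<^sup>2)) * (cmod (p z + cnj (p a)))\<^sup>2"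
    by (simp add: cmod_diff_sq[symmetric] cmod_add_cnj_sq[symmetric] power_mult_distrib)
  then show ?thesis
    by (simp add: algebra_simps)
qed

text \<open>Both sides are continuous in e when p is replaced by p + e, so \<open>pick_pos\<close>
  survives the limit from the right at e = 0.\<close>

lemma pick:
  assumes p: "p holomorphic_on unit_disc" "\<And>z. z \<in> unit_disc \<Longrightarrow> Re (p z) \<ge> 0"
    and z: "z \<in> unit_disc" and a: "a \<in> unit_disc"
  shows "(1 - (cmod z)\<^sup>2) * (1 - (cmod a)\<^sup>2) * (cmod (p z + cnj (p a)))\<^sup>2
         \<le> 4 * Re (p z) * Re (p a) * (cmod (1 - cnj a * z))\<^sup>2"
proof -
  define L where "L = (\<lambda>e::real. (1 - (cmod z)\<^sup>2) * (1 - (cmod a)\<^sup>2) * (cmod (p z + of_real e + cnj (p a + of_real e)))\<^sup>2)"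
  define R where "R = (\<lambda>e::real. 4 * Re (p z + of_real e) * Re (p a + of_real e) * (cmod (1 - cnj a * z))\<^sup>2)"
  have "L e \<le> R e" if "e > 0" for e
    unfolding L_def R_def
    by (rule pick_pos) (use p(2) that z a in \<open>auto intro!: holomorphic_intros p(1) add_nonneg_pos\<close>)
  then have "\<forall>\<^sub>F e in at_right 0. L e \<le> R e"
    by (auto simp: eventually_at_filter)
  moreover have "(L \<longlongrightarrow> L 0) (at_right 0)" "(R \<longlongrightarrow> R 0) (at_right 0)"
    unfolding L_def R_def by (auto intro!: tendsto_eq_intros)
  ultimately have "L 0 \<le> R 0"
    by (intro tendsto_le[of "at_right (0::real)"]) auto
  then show ?thesis by (simp add: L_def R_def)
qed

text \<open>With \<open>Re (p a) = 0\<close> the right side of Pick vanishes, which leaves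
  \<open>p z = - cnj (p a)\<close>. It gives both the zero-freeness of generators and the rigidity
  of the extremal case.\<close>

lemma pick_const:
  assumes "p holomorphic_on unit_disc" "\<And>z. z \<in> unit_disc \<Longrightarrow> Re (p z) \<ge> 0"
    and a: "a \<in> unit_disc" "Re (p a) = 0" and z: "z \<in> unit_disc"
  shows "p z = p a"
proof -
  define c where "c = (1 - (cmod z)\<^sup>2) * (1 - (cmod a)\<^sup>2)"
  have "c > 0"
    unfolding c_def by (intro mult_pos_pos unit_disc_sq_lt z a)
  moreover have "c * (cmod (p z + cnj (p a)))\<^sup>2 \<le> 0"
    using pick[OF assms(1,2) z a(1)] a(2) by (simp add: c_def)
  ultimately have "p z + cnj (p a) = 0"
    by (simp add: mult_le_0_iff)
  moreover have "cnj (p a) = - p a"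
    using a(2) by (simp add: complex_eq_iff)
  ultimately show ?thesis by simp
qed

section \<open>Boundary atoms\<close>

abbreviation stolz :: "complex \<Rightarrow> real \<Rightarrow> complex set" where
  "stolz \<sigma> M \<equiv> {z \<in> unit_disc. cmod (\<sigma> - z) < M * (1 - cmod z)}"

text \<open>On the radius to \<sigma> the distance to \<sigma> equals 1 - |z|, so M > 1 puts the
  radius into the region. Hence the filter is nontrivial and angular limits are unique, on which the
  definite description in \<open>beta\<close> relies.\<close>

lemma filterlim_radial_stolz:
  assumes "cmod \<sigma> = 1" "M > 1"
  shows "filterlim (\<lambda>r. of_real r * \<sigma>) (at \<sigma> within stolz \<sigma> M) (at_left 1)"
  unfolding filterlim_at
proof
  have "((\<lambda>r. of_real r * \<sigma>) \<longlongrightarrow> of_real 1 * \<sigma>) (at_left 1)"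
    by (intro tendsto_intros)
  then show "((\<lambda>r. of_real r * \<sigma>) \<longlongrightarrow> \<sigma>) (at_left 1)" by simp
  have "of_real r * \<sigma> \<in> stolz \<sigma> M \<and> of_real r * \<sigma> \<noteq> \<sigma>" if "0 < r" "r < 1" for r
  proof -
    have "\<sigma> - of_real r * \<sigma> = of_real (1 - r) * \<sigma>" by (simp add: algebra_simps)
    then have "cmod (\<sigma> - of_real r * \<sigma>) = 1 - r"
      using that assms by (simp only: norm_mult norm_of_real) simp
    moreover have "cmod (of_real r * \<sigma>) = r"
      using that assms by (simp add: norm_mult)
    moreover have "1 - r < M * (1 - r)" using that assms by simp
    moreover have "of_real r * \<sigma> \<noteq> \<sigma>" using that assms by auto
    ultimately show ?thesis using that by simp
  qed
  moreover have "\<forall>\<^sub>F r in at_left (1::real). 0 < r \<and> r < 1"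
    by (rule eventually_at_leftI[of 0]) auto
  ultimately show "\<forall>\<^sub>F r in at_left 1. of_real r * \<sigma> \<in> stolz \<sigma> M \<and> of_real r * \<sigma> \<noteq> \<sigma>"
    by (auto elim!: eventually_mono)
qed

lemma at_within_stolz_ne_bot:
  assumes "cmod \<sigma> = 1" "M > 1"
  shows "at \<sigma> within stolz \<sigma> M \<noteq> bot"
  using filterlim_radial_stolz[OF assms] trivial_limit_at_left_real[of 1]
  by (auto simp: filterlim_def filtermap_bot_iff bot_unique)

lemma angular_limit_unique:
  assumes "cmod \<sigma> = 1" "angular_limit f \<sigma> a" "angular_limit f \<sigma> b"
  shows "a = b"
proof -
  have "(f \<longlongrightarrow> a) (at \<sigma> within stolz \<sigma> 2)" "(f \<longlongrightarrow> b) (at \<sigma> within stolz \<sigma> 2)"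
    using assms unfolding angular_limit_def by (meson one_less_numeral_iff semiring_norm(76))+
  then show ?thesis
    using tendsto_unique at_within_stolz_ne_bot[OF assms(1), of 2] by fastforce
qed

lemma angular_limit_cong:
  assumes "\<And>z. z \<in> unit_disc \<Longrightarrow> f z = g z"
  shows "angular_limit f \<sigma> a \<longleftrightarrow> angular_limit g \<sigma> a"
  unfolding angular_limit_def
  by (intro all_cong1 imp_cong refl filterlim_cong) (use assms in \<open>auto simp: eventually_at_filter\<close>)

lemma tendsto_angular_limit: "(f \<longlongrightarrow> a) (at \<sigma> within unit_disc) \<Longrightarrow> angular_limit f \<sigma> a"
  unfolding angular_limit_def by (auto elim: tendsto_within_subset)

lemma angular_limit_diff:
  "angular_limit f \<sigma> a \<Longrightarrow> angular_limit g \<sigma> b \<Longrightarrow> angular_limit (\<lambda>z. f z - g z) \<sigma> (a - b)"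
  unfolding angular_limit_def by (intro allI impI tendsto_diff; blast)

lemma angular_limit_mult:
  "angular_limit f \<sigma> a \<Longrightarrow> angular_limit g \<sigma> b \<Longrightarrow> angular_limit (\<lambda>z. f z * g z) \<sigma> (a * b)"
  unfolding angular_limit_def by (intro allI impI tendsto_mult; blast)

lemma angular_limit_divide:
  "angular_limit f \<sigma> a \<Longrightarrow> angular_limit g \<sigma> b \<Longrightarrow> b \<noteq> 0 \<Longrightarrow> angular_limit (\<lambda>z. f z / g z) \<sigma> (a / b)"
  unfolding angular_limit_def by (intro allI impI tendsto_divide; blast)

text \<open>The mass at \<open>\<sigma>\<close> of the measure that represents \<open>p\<close> in Herglotz' formula, written so that no
  measure is needed.\<close>

definition mass :: "(complex \<Rightarrow> complex) \<Rightarrow> complex \<Rightarrow> real" where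
  "mass p \<sigma> = (INF z\<in>unit_disc. Re (p z) / Re (cay \<sigma> z))"

context
  fixes p :: "complex \<Rightarrow> complex" and \<sigma> :: complex
  assumes hol: "p holomorphic_on unit_disc" and Re: "\<And>z. z \<in> unit_disc \<Longrightarrow> Re (p z) \<ge> 0"
    and \<sigma>: "cmod \<sigma> = 1"
begin

lemma mass_bdd: "bdd_below ((\<lambda>z. Re (p z) / Re (cay \<sigma> z)) ` unit_disc)"
  using Re Re_cay_pos[OF \<sigma>] by (intro bdd_belowI2[of _ 0]) (auto intro!: divide_nonneg_pos)

lemma mass_nonneg: "mass p \<sigma> \<ge> 0"
  unfolding mass_def using Re Re_cay_pos[OF \<sigma>] by (intro cINF_greatest) (auto intro!: divide_nonneg_pos)

lemma mass_le_Re: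
  assumes "z \<in> unit_disc" shows "mass p \<sigma> * Re (cay \<sigma> z) \<le> Re (p z)"
proof -
  have "mass p \<sigma> \<le> Re (p z) / Re (cay \<sigma> z)"
    unfolding mass_def by (rule cINF_lower[OF mass_bdd assms])
  then show ?thesis using Re_cay_pos[OF \<sigma> assms] by (simp add: pos_le_divide_eq)
qed

text \<open>Without its atom, \<open>p\<close> has \<open>Re (p1 a) \<le> e * Re (cay \<sigma> a)\<close> for some \<open>a\<close>; the Pick inequality at
  \<open>a\<close> turns this into a bound for \<open>(1 - \<bar>z\<bar>) * \<bar>p1 z\<bar>\<close> of order \<open>e\<close> near \<open>\<sigma>\<close>.\<close>

lemma angular_limit_mass: "angular_limit (\<lambda>z. (\<sigma> - z) * p z) \<sigma> (2 * \<sigma> * of_real (mass p \<sigma>))"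
  unfolding angular_limit_def
proof safe
  fix M :: real assume M: "M > 1"
  define m where "m = mass p \<sigma>"
  define p1 where "p1 = (\<lambda>z. p z - of_real m * cay \<sigma> z)"
  let ?F = "at \<sigma> within stolz \<sigma> M"
  have hol1: "p1 holomorphic_on unit_disc"
    unfolding p1_def by (intro holomorphic_intros hol holomorphic_cay \<sigma>)
  have Re1: "Re (p1 z) \<ge> 0" if "z \<in> unit_disc" for z
    using mass_le_Re[OF that] by (simp add: p1_def m_def)
  have inF: "\<forall>\<^sub>F z in ?F. z \<in> stolz \<sigma> M"
    by (simp add: eventually_at_filter)
  have "((\<lambda>z. (1 - cmod z) * cmod (p1 z)) \<longlongrightarrow> 0) ?F"
  proof (rule order_tendstoI)
    fix y :: real assume y: "y < 0"
    show "\<forall>\<^sub>F z in ?F. y < (1 - cmod z) * cmod (p1 z)"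
      using inF
    proof eventually_elim
      case (elim z)
      then have "0 \<le> (1 - cmod z) * cmod (p1 z)" by simp
      with y show ?case by linarith
    qed
  next
    fix y :: real assume y: "0 < y"
    \<comment> \<open>The bound derived below tends to 4 * e at \<sigma>; a fifth of y leaves room
      for strict inequality.\<close>
    define e where "e = y / 5"
    have e: "e > 0" using y by (simp add: e_def)
    have "\<exists>z0\<in>unit_disc. Re (p z0) / Re (cay \<sigma> z0) < m + e"
      using e cINF_less_iff[OF _ mass_bdd, of "m + e"] by (auto simp: m_def mass_def)
    then obtain a where a: "a \<in> unit_disc" and "Re (p a) / Re (cay \<sigma> a) < m + e" by blast
    then have "Re (p1 a) < e * Re (cay \<sigma> a)"
      using Re_cay_pos[OF \<sigma> a] by (simp add: p1_def divide_less_eq algebra_simps)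
    then have Ra: "Re (p1 a) \<le> e * ((1 - (cmod a)\<^sup>2) / (cmod (\<sigma> - a))\<^sup>2)"
      using Re_cay[OF \<sigma>, of a] unit_disc_ne[OF \<sigma> a] by auto
    define q where "q = (\<lambda>z. (cmod (1 - cnj a * z))\<^sup>2 / (cmod (\<sigma> - a))\<^sup>2)"
    have bound: "(1 - cmod z) * cmod (p1 z) \<le> 2 * cmod (p1 a) * (1 - cmod z) + 4 * e * q z"
      if z: "z \<in> unit_disc" for z
    proof -
      define X where "X = cmod (p1 z)"
      have q0: "q z \<ge> 0" by (simp add: q_def)
      have d: "1 - (cmod a)\<^sup>2 > 0" by (rule unit_disc_sq_lt[OF a])
      have "(1 - (cmod z)\<^sup>2) * (1 - (cmod a)\<^sup>2) * (cmod (p1 z + cnj (p1 a)))\<^sup>2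
          \<le> 4 * Re (p1 z) * Re (p1 a) * (cmod (1 - cnj a * z))\<^sup>2"
        by (rule pick[OF hol1 Re1 z a])
      also have "\<dots> \<le> 4 * X * (e * ((1 - (cmod a)\<^sup>2) / (cmod (\<sigma> - a))\<^sup>2)) * (cmod (1 - cnj a * z))\<^sup>2"
        by (intro mult_right_mono mult_mono Ra) (use Re1[OF z] Re1[OF a] in \<open>auto simp: X_def complex_Re_le_cmod\<close>)
      also have "\<dots> = (1 - (cmod a)\<^sup>2) * (4 * X * e * q z)"
        by (simp add: q_def)
      finally have 1: "(1 - (cmod z)\<^sup>2) * (cmod (p1 z + cnj (p1 a)))\<^sup>2 \<le> 4 * X * e * q z"
        using d by (simp add: mult.assoc mult.left_commute)
      have "X \<le> cmod (p1 z + cnj (p1 a)) + cmod (p1 a)"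
        unfolding X_def by (metis add_diff_cancel_right' complex_mod_cnj norm_triangle_ineq4)
      show ?thesis
      proof (cases "X \<le> 2 * cmod (p1 a)")
        case True
        then have "(1 - cmod z) * X \<le> (1 - cmod z) * (2 * cmod (p1 a))"
          using z by (intro mult_left_mono) auto
        then show ?thesis using q0 e by (simp add: X_def mult.commute add_increasing2)
      next
        case False
        then have X: "X > 0" by (meson not_le order_trans norm_ge_zero mult_nonneg_nonneg zero_le_numeral le_less_trans)
        \<comment> \<open>Pick is quadratic in X on the left and linear on the right. Lowering the
          square to a multiple of X lets one factor X cancel.\<close>
        have "X * (X - 2 * cmod (p1 a)) \<le> (X - cmod (p1 a))\<^sup>2"
          by (simp add: power2_eq_square algebra_simps)
        also have "\<dots> \<le> (cmod (p1 z + cnj (p1 a)))\<^sup>2"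
          using \<open>X \<le> _\<close> False norm_ge_zero[of "p1 a"] by (intro power_mono) linarith+
        finally have 2: "X * (X - 2 * cmod (p1 a)) \<le> (cmod (p1 z + cnj (p1 a)))\<^sup>2" .
        have "(cmod z)\<^sup>2 \<le> cmod z"
          using z by (simp add: power2_eq_square mult_left_le)
        then have "(1 - cmod z) * (X * (X - 2 * cmod (p1 a))) \<le> (1 - (cmod z)\<^sup>2) * (cmod (p1 z + cnj (p1 a)))\<^sup>2"
          using z X False by (intro mult_mono 2) (auto simp: abs_square_le_1)
        with 1 have "X * ((1 - cmod z) * (X - 2 * cmod (p1 a))) \<le> X * (4 * e * q z)"
          by (simp add: algebra_simps)
        then have "(1 - cmod z) * (X - 2 * cmod (p1 a)) \<le> 4 * e * q z"
          using X by (simp only: mult_le_cancel_left_pos)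
        then show ?thesis by (simp add: X_def algebra_simps)
      qed
    qed
    have "\<sigma> - a \<noteq> 0" by (rule unit_disc_ne[OF \<sigma> a])
    have "1 - cnj a * \<sigma> = \<sigma> * cnj (\<sigma> - a)"
      using cnj_unit[OF \<sigma>] by (simp add: algebra_simps)
    then have "cmod (1 - cnj a * \<sigma>) = cmod (\<sigma> - a)"
      using \<sigma> by (metis complex_mod_cnj mult_1 norm_mult)
    then have q1: "q \<sigma> = 1" using \<open>\<sigma> - a \<noteq> 0\<close> by (simp add: q_def)
    have "((\<lambda>z. 2 * cmod (p1 a) * (1 - cmod z) + 4 * e * q z) \<longlongrightarrow> 2 * cmod (p1 a) * (1 - cmod \<sigma>) + 4 * e * q \<sigma>) ?F"
      unfolding q_def by (intro tendsto_intros) (use \<open>\<sigma> - a \<noteq> 0\<close> in auto)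
    moreover have "2 * cmod (p1 a) * (1 - cmod \<sigma>) + 4 * e * q \<sigma> < y"
      using y \<sigma> q1 by (simp add: e_def)
    ultimately have "\<forall>\<^sub>F z in ?F. 2 * cmod (p1 a) * (1 - cmod z) + 4 * e * q z < y"
      by (rule order_tendstoD(2))
    with inF show "\<forall>\<^sub>F z in ?F. (1 - cmod z) * cmod (p1 z) < y"
      by eventually_elim (use bound in force)
  qed
  \<comment> \<open>Only from here on is the shape of the Stolz region used: it trades |\<sigma> -
    z| for M * (1 - |z|).\<close>
  then have "((\<lambda>z. M * ((1 - cmod z) * cmod (p1 z))) \<longlongrightarrow> M * 0) ?F"
    by (intro tendsto_intros)
  then have "((\<lambda>z. M * ((1 - cmod z) * cmod (p1 z))) \<longlongrightarrow> 0) ?F" by simp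
  then have "((\<lambda>z. (\<sigma> - z) * p1 z) \<longlongrightarrow> 0) ?F"
  proof (rule Lim_null_comparison[rotated])
    show "\<forall>\<^sub>F z in ?F. cmod ((\<sigma> - z) * p1 z) \<le> M * ((1 - cmod z) * cmod (p1 z))"
      using inF
    proof eventually_elim
      case (elim z)
      then have "cmod (\<sigma> - z) * cmod (p1 z) \<le> (M * (1 - cmod z)) * cmod (p1 z)"
        by (intro mult_right_mono) auto
      then show ?case by (simp add: norm_mult mult.assoc)
    qed
  qed
  then have "((\<lambda>z. (\<sigma> - z) * p1 z + of_real m * (\<sigma> + z)) \<longlongrightarrow> 0 + of_real m * (\<sigma> + \<sigma>)) ?F"
    by (intro tendsto_intros)
  moreover have "\<forall>\<^sub>F z in ?F. (\<sigma> - z) * p1 z + of_real m * (\<sigma> + z) = (\<sigma> - z) * p z"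
    using inF
  proof eventually_elim
    case (elim z)
    then have "(\<sigma> - z) * cay \<sigma> z = \<sigma> + z" using \<sigma> by (intro mult_cay) auto
    then show ?case by (simp add: p1_def right_diff_distrib mult.left_commute)
  qed
  ultimately have "((\<lambda>z. (\<sigma> - z) * p z) \<longlongrightarrow> 0 + of_real m * (\<sigma> + \<sigma>)) ?F"
    by (rule Lim_transform_eventually)
  then show "((\<lambda>z. (\<sigma> - z) * p z) \<longlongrightarrow> 2 * \<sigma> * of_real (mass p \<sigma>)) ?F"
    by (simp add: m_def algebra_simps)
qed

lemma mass_eqI:
  assumes "angular_limit (\<lambda>z. (\<sigma> - z) * p z) \<sigma> (2 * \<sigma> * of_real m)"
  shows "mass p \<sigma> = m"
proof -
  have "2 * \<sigma> * of_real (mass p \<sigma>) = 2 * \<sigma> * of_real m"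
    by (rule angular_limit_unique[OF \<sigma> angular_limit_mass assms])
  then show ?thesis using \<sigma> by auto
qed

end

text \<open>For s \<noteq> t the function \<open>cay s\<close> is continuous at t, so removing the
  atoms already treated leaves the mass at t unchanged; \<open>mass_le_Re\<close> then applies to
  the remainder.\<close>

lemma sum_mass_le_Re:
  assumes "finite S" "\<And>s. s \<in> S \<Longrightarrow> cmod s = 1"
    and hol: "p holomorphic_on unit_disc" and Re: "\<And>z. z \<in> unit_disc \<Longrightarrow> Re (p z) \<ge> 0"
  shows "z \<in> unit_disc \<Longrightarrow> (\<Sum>s\<in>S. mass p s * Re (cay s z)) \<le> Re (p z)"
  using assms(1,2)
proof (induction S arbitrary: z rule: finite_induct)
  case empty
  then show ?case using Re by simp
next
  case (insert t S)
  define p' where "p' = (\<lambda>z. p z - (\<Sum>s\<in>S. of_real (mass p s) * cay s z))"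
  have t: "cmod t = 1" using insert by auto
  have hol': "p' holomorphic_on unit_disc"
    unfolding p'_def by (intro holomorphic_intros hol holomorphic_cay) (use insert in auto)
  have Re': "Re (p' w) \<ge> 0" if "w \<in> unit_disc" for w
    using insert.IH[OF that] insert.prems by (simp add: p'_def)
  have "mass p' t = mass p t"
  proof (rule mass_eqI[OF hol' Re' t])
    have "((\<lambda>z. (t - z) * (\<Sum>s\<in>S. of_real (mass p s) * cay s z)) \<longlongrightarrow>
        (t - t) * (\<Sum>s\<in>S. of_real (mass p s) * cay s t)) (at t within unit_disc)"
      unfolding cay_def by (intro tendsto_intros) (use insert in auto)
    then have "angular_limit (\<lambda>z. (t - z) * (\<Sum>s\<in>S. of_real (mass p s) * cay s z)) t 0"
      by (intro tendsto_angular_limit) simp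
    moreover have "angular_limit (\<lambda>z. (t - z) * p z) t (2 * t * of_real (mass p t))"
      by (rule angular_limit_mass[OF hol Re t])
    ultimately have "angular_limit (\<lambda>z. (t - z) * p z - (t - z) * (\<Sum>s\<in>S. of_real (mass p s) * cay s z)) t
            (2 * t * of_real (mass p t) - 0)"
      by (intro angular_limit_diff)
    then show "angular_limit (\<lambda>z. (t - z) * p' z) t (2 * t * of_real (mass p t))"
      by (simp add: p'_def right_diff_distrib)
  qed
  moreover have "mass p' t * Re (cay t z) \<le> Re (p' z)"
    by (rule mass_le_Re[OF hol' Re' t insert.prems(1)])
  ultimately show ?case using insert.hyps by (simp add: p'_def)
qed

section \<open>Semigroups and their generators\<close>

text \<open>Julia's inequality as a case of \<open>mass_le_Re\<close>: (\<sigma> - z) * cay \<sigma>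
  (f z) is \<sigma> + f z divided by the difference quotient of f, so it tends to 2\<sigma>/d and
  the mass of the composed function is 1/d.\<close>

lemma julia:
  assumes hol: "f holomorphic_on unit_disc" and maps: "f ` unit_disc \<subseteq> unit_disc"
    and \<sigma>: "cmod \<sigma> = 1" and "d > 0"
    and fixpt: "angular_limit f \<sigma> \<sigma>"
    and der: "angular_limit (\<lambda>z. (f z - \<sigma>) / (z - \<sigma>)) \<sigma> (of_real d)"
    and z: "z \<in> unit_disc"
  shows "Re (cay \<sigma> z) \<le> d * Re (cay \<sigma> (f z))"
proof -
  define p where "p = (\<lambda>z. cay \<sigma> (f z))"
  have f: "f w \<in> unit_disc" if "w \<in> unit_disc" for w using maps that by blast
  have holp: "p holomorphic_on unit_disc"
    using holomorphic_on_compose_gen[OF hol holomorphic_cay[OF \<sigma>] maps] by (simp add: p_def o_def)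
  have Rep: "Re (p w) \<ge> 0" if "w \<in> unit_disc" for w
    using Re_cay_pos[OF \<sigma> f[OF that]] by (simp add: p_def)
  have "mass p \<sigma> = 1 / d"
  proof (rule mass_eqI[OF holp Rep \<sigma>])
    have "angular_limit (\<lambda>z. \<sigma> - - f z) \<sigma> (\<sigma> - - \<sigma>)"
      using fixpt unfolding angular_limit_def by (intro allI impI tendsto_intros; blast)
    from angular_limit_divide[OF this der]
    have "angular_limit (\<lambda>z. (\<sigma> + f z) / ((f z - \<sigma>) / (z - \<sigma>))) \<sigma> (2 * \<sigma> * of_real (1 / d))"
      using \<open>d > 0\<close> by simp
    moreover have "(\<sigma> + f z) / ((f z - \<sigma>) / (z - \<sigma>)) = (\<sigma> - z) * p z" if "z \<in> unit_disc" for z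
      using unit_disc_ne[OF \<sigma> that] unit_disc_ne[OF \<sigma> f[OF that]]
      by (simp add: p_def cay_def divide_simps) (simp add: algebra_simps)
    ultimately show "angular_limit (\<lambda>z. (\<sigma> - z) * p z) \<sigma> (2 * \<sigma> * of_real (1 / d))"
      by (subst (asm) angular_limit_cong) auto
  qed
  moreover have "mass p \<sigma> * Re (cay \<sigma> z) \<le> Re (p z)"
    by (rule mass_le_Re[OF holp Rep \<sigma> z])
  ultimately have "1 / d * Re (cay \<sigma> z) \<le> Re (cay \<sigma> (f z))" by (simp add: p_def)
  then show ?thesis
    using \<open>d > 0\<close> by (simp add: divide_le_eq mult.commute)
qed

text \<open>The Pick inequality is applied to \<open>z\<close> and the points \<open>a n\<close> of the orbit of \<open>0\<close>. Since
  \<open>a n\<close> tends to the unit circle, \<open>\<bar>a n\<bar> \<le> \<bar>a (n + 1)\<bar>\<close> holds infinitely often.\<close>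

lemma wolff:
  assumes \<phi>: "is_semigroup \<phi>" and DW: "boundary_DW_point \<phi> \<tau>" and \<tau>: "cmod \<tau> = 1"
    and t: "t > 0" and z: "z \<in> unit_disc"
  shows "Re (cay \<tau> z) \<le> Re (cay \<tau> (\<phi> t z))"
proof -
  define f where "f = \<phi> t"
  have hol: "f holomorphic_on unit_disc" and maps: "f ` unit_disc \<subseteq> unit_disc"
    using \<phi> t by (auto simp: is_semigroup_def f_def)
  have f: "f w \<in> unit_disc" if "w \<in> unit_disc" for w using maps that by blast
  define p where "p = (\<lambda>z. cay \<tau> (f z))"
  have holp: "p holomorphic_on unit_disc"
    using holomorphic_on_compose_gen[OF hol holomorphic_cay[OF \<tau>] maps] by (simp add: p_def o_def)
  have Rep: "Re (p w) > 0" if "w \<in> unit_disc" for w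
    using Re_cay_pos[OF \<tau> f[OF that]] by (simp add: p_def)
  define a where "a = (\<lambda>n. \<phi> (real n * t) 0)"
  have a_in: "a n \<in> unit_disc" for n
  proof -
    have "\<phi> (real n * t) ` unit_disc \<subseteq> unit_disc"
      using \<phi> t unfolding is_semigroup_def by (meson mult_nonneg_nonneg of_nat_0_le_iff less_imp_le)
    then show ?thesis by (force simp: a_def)
  qed
  have fa: "f (a n) = a (Suc n)" for n
  proof -
    have "f (a n) = \<phi> (t + real n * t) 0"
      using \<phi> t by (simp add: is_semigroup_def f_def a_def)
    then show ?thesis by (simp add: a_def algebra_simps)
  qed
  have "filterlim (\<lambda>n. real n * t) at_top sequentially"
    using t by (intro filterlim_at_top_mult_tendsto_pos[OF tendsto_const] filterlim_real_sequentially)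
      (auto simp: mult.commute)
  moreover have "((\<lambda>t. \<phi> t 0) \<longlongrightarrow> \<tau>) at_top"
    using DW by (simp add: boundary_DW_point_def)
  ultimately have lim: "a \<longlonglongrightarrow> \<tau>"
    unfolding a_def using filterlim_compose by blast
  \<comment> \<open>Up to the common factor 4 / |\<tau> - a (n+1)|^2, Pick reads (1 - |a n|^2) * L n
    \<le> (1 - |a (n+1)|^2) * R n, because f moves \<open>a n\<close> to \<open>a (Suc n)\<close>.
    When the modulus does not drop, both weights can be discarded.\<close>
  define L where "L = (\<lambda>n. (1 - (cmod z)\<^sup>2) * (cmod (1 - f z * cnj (a (Suc n))))\<^sup>2 / (cmod (\<tau> - f z))\<^sup>2)"
  define R where "R = (\<lambda>n. Re (p z) * (cmod (1 - cnj (a n) * z))\<^sup>2)"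
  have le: "L n \<le> R n" if "cmod (a n) \<le> cmod (a (Suc n))" for n
  proof -
    define X where "X = (cmod (1 - f z * cnj (a (Suc n))))\<^sup>2 / (cmod (\<tau> - f z))\<^sup>2"
    define x u v where "x = 1 - (cmod z)\<^sup>2" and "u = 1 - (cmod (a n))\<^sup>2" and "v = 1 - (cmod (a (Suc n)))\<^sup>2"
    define D where "D = (cmod (\<tau> - a (Suc n)))\<^sup>2"
    have D: "D > 0" using unit_disc_ne[OF \<tau> a_in] by (simp add: D_def)
    have ne: "f z \<noteq> \<tau>" "a (Suc n) \<noteq> \<tau>" using unit_disc_ne[OF \<tau> f[OF z]] unit_disc_ne[OF \<tau> a_in[of "Suc n"]] by auto
    have "p z + cnj (p (a n)) = 2 * (1 - f z * cnj (a (Suc n))) / ((\<tau> - f z) * cnj (\<tau> - a (Suc n)))"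
      unfolding p_def fa by (rule cay_add_cnj[OF \<tau> ne])
    then have 1: "(cmod (p z + cnj (p (a n))))\<^sup>2 = 4 * X / D"
      by (simp only: norm_divide norm_mult complex_mod_cnj power_divide power_mult_distrib)
        (simp add: X_def D_def)
    have 2: "Re (p (a n)) = (1 - (cmod (a (Suc n)))\<^sup>2) / D"
      unfolding p_def fa D_def by (rule Re_cay[OF \<tau> ne(2)])
    have "(1 - (cmod z)\<^sup>2) * (1 - (cmod (a n))\<^sup>2) * (cmod (p z + cnj (p (a n))))\<^sup>2
         \<le> 4 * Re (p z) * Re (p (a n)) * (cmod (1 - cnj (a n) * z))\<^sup>2"
      by (rule pick_pos[OF holp Rep z a_in])
    then have "x * u * (4 * X / D) \<le> 4 * Re (p z) * (v / D) * (cmod (1 - cnj (a n) * z))\<^sup>2"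
      unfolding 1 2 x_def u_def v_def .
    then have "(4 / D) * (u * (x * X)) \<le> (4 / D) * (v * R n)"
      by (simp add: R_def ac_simps)
    then have "(4 / D) * ((1 - (cmod (a n))\<^sup>2) * ((1 - (cmod z)\<^sup>2) * X)) \<le> (4 / D) * ((1 - (cmod (a (Suc n)))\<^sup>2) * R n)"
      unfolding x_def u_def v_def .
    then have "(1 - (cmod (a n))\<^sup>2) * ((1 - (cmod z)\<^sup>2) * X) \<le> (1 - (cmod (a (Suc n)))\<^sup>2) * R n"
      by (rule mult_left_le_imp_le) (use D in simp)
    also have "\<dots> \<le> (1 - (cmod (a n))\<^sup>2) * R n"
    proof (rule mult_right_mono)
      have "(cmod (a n))\<^sup>2 \<le> (cmod (a (Suc n)))\<^sup>2" using that by (intro power_mono) auto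
      then show "1 - (cmod (a (Suc n)))\<^sup>2 \<le> 1 - (cmod (a n))\<^sup>2" by simp
      show "0 \<le> R n" using Rep[OF z] by (simp add: R_def)
    qed
    finally have "(1 - (cmod z)\<^sup>2) * X \<le> R n"
      using unit_disc_sq_lt[OF a_in[of n]] by (simp only: mult_le_cancel_left_pos)
    then show ?thesis by (simp add: L_def X_def)
  qed
  have "L \<longlonglongrightarrow> (1 - (cmod z)\<^sup>2) * (cmod (1 - f z * cnj \<tau>))\<^sup>2 / (cmod (\<tau> - f z))\<^sup>2"
    unfolding L_def by (intro tendsto_intros LIMSEQ_Suc[OF lim]) (use unit_disc_ne[OF \<tau> f[OF z]] in auto)
  moreover have eq: "cmod (1 - w * cnj \<tau>) = cmod (\<tau> - w)" for w
  proof -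
    have "1 - w * cnj \<tau> = cnj \<tau> * (\<tau> - w)"
      using cnj_unit[OF \<tau>] by (simp add: algebra_simps)
    then show ?thesis using \<tau> by (simp add: norm_mult)
  qed
  ultimately have limL: "L \<longlonglongrightarrow> 1 - (cmod z)\<^sup>2"
    using unit_disc_ne[OF \<tau> f[OF z]] by simp
  have "R \<longlonglongrightarrow> Re (p z) * (cmod (1 - cnj \<tau> * z))\<^sup>2"
    unfolding R_def by (intro tendsto_intros lim)
  then have limR: "R \<longlonglongrightarrow> Re (p z) * (cmod (\<tau> - z))\<^sup>2"
    using eq[of z] by (simp add: mult.commute)
  have "1 - (cmod z)\<^sup>2 \<le> Re (p z) * (cmod (\<tau> - z))\<^sup>2"
  \<comment> \<open>Otherwise L exceeds R from some N on, and the moduli of the orbit decrease from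
    there; they could not tend to 1.\<close>
  proof (rule ccontr)
    assume "\<not> ?thesis"
    then have "1 - (cmod z)\<^sup>2 - Re (p z) * (cmod (\<tau> - z))\<^sup>2 > 0" by simp
    with tendsto_diff[OF limL limR] have "\<forall>\<^sub>F n in sequentially. L n - R n > 0"
      by (rule order_tendstoD(1))
    then obtain N where N: "\<And>n. n \<ge> N \<Longrightarrow> L n > R n"
      by (auto simp: eventually_sequentially)
    then have dec: "cmod (a (Suc n)) \<le> cmod (a n)" if "n \<ge> N" for n
      using le[of n] that by force
    have "cmod (a n) \<le> cmod (a N)" if "n \<ge> N" for n
      using that by (induction n rule: dec_induct) (auto intro: order_trans[OF dec])
    then have "\<forall>\<^sub>F n in sequentially. cmod (a n) \<le> cmod (a N)"
      by (auto simp: eventually_sequentially)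
    with tendsto_norm[OF lim] have "cmod \<tau> \<le> cmod (a N)"
      by (intro tendsto_upperbound) auto
    then show False using a_in[of N] \<tau> by simp
  qed
  then have "(1 - (cmod z)\<^sup>2) / (cmod (\<tau> - z))\<^sup>2 \<le> Re (p z)"
    using unit_disc_ne[OF \<tau> z] by (simp add: divide_le_eq)
  then show ?thesis
    using Re_cay[OF \<tau>, of z] unit_disc_ne[OF \<tau> z] by (auto simp: p_def f_def)
qed

lemma DERIV_cay: "z \<noteq> \<sigma> \<Longrightarrow> (cay \<sigma> has_field_derivative 2 * \<sigma> / (\<sigma> - z)\<^sup>2) (at z within S)"
  unfolding cay_def
  by (rule derivative_eq_intros refl | simp)+ (auto simp: divide_simps power2_eq_square algebra_simps)

text \<open>The hypothesis is an equality at t = 0, so its right derivative there has a sign; 2 *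
  \<sigma> * G z / (\<sigma> - z)^2 is the velocity of \<open>cay \<sigma>\<close> along the flow.
  \<open>wolff\<close> supplies the case \<mu> = 0, \<open>julia\<close> the case of a spectral
  value.\<close>

lemma Re_generator_ge:
  assumes \<phi>: "is_semigroup \<phi>" and G: "is_generator_of G \<phi>" and \<sigma>: "cmod \<sigma> = 1"
    and z: "z \<in> unit_disc"
    and le: "\<And>t. t > 0 \<Longrightarrow> exp (\<mu> * t) * Re (cay \<sigma> z) \<le> Re (cay \<sigma> (\<phi> t z))"
  shows "\<mu> * Re (cay \<sigma> z) \<le> Re (2 * \<sigma> * G z / (\<sigma> - z)\<^sup>2)"
proof -
  define h where "h = (\<lambda>t. Re (cay \<sigma> (\<phi> t z)) - exp (\<mu> * t) * Re (cay \<sigma> z))"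
  have \<phi>0: "\<phi> 0 z = z" using \<phi> z by (simp add: is_semigroup_def)
  have "((\<lambda>s. \<phi> s z) has_vector_derivative G z) (at 0 within {0..})"
    using G z \<phi>0 by (auto simp: is_generator_of_def dest!: bspec[of _ _ z])
  moreover have "(cay \<sigma> has_field_derivative 2 * \<sigma> / (\<sigma> - \<phi> 0 z)\<^sup>2) (at (\<phi> 0 z) within (\<lambda>s. \<phi> s z) ` {0..})"
    using unit_disc_ne[OF \<sigma> z] \<phi>0 by (intro DERIV_cay) auto
  ultimately have "((cay \<sigma> \<circ> (\<lambda>s. \<phi> s z)) has_vector_derivative G z * (2 * \<sigma> / (\<sigma> - \<phi> 0 z)\<^sup>2)) (at 0 within {0..})"
    by (rule field_vector_diff_chain_within)
  then have "((\<lambda>s. cay \<sigma> (\<phi> s z)) has_vector_derivative 2 * \<sigma> * G z / (\<sigma> - z)\<^sup>2) (at 0 within {0..})"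
    by (simp add: o_def \<phi>0 mult.commute mult.left_commute)
  then have "((\<lambda>s. Re (cay \<sigma> (\<phi> s z))) has_vector_derivative Re (2 * \<sigma> * G z / (\<sigma> - z)\<^sup>2)) (at 0 within {0..})"
    by (rule bounded_linear.has_vector_derivative[OF bounded_linear_Re])
  then have "((\<lambda>s. Re (cay \<sigma> (\<phi> s z))) has_real_derivative Re (2 * \<sigma> * G z / (\<sigma> - z)\<^sup>2)) (at 0 within {0..})"
    by (simp add: has_real_derivative_iff_has_vector_derivative)
  moreover have "((\<lambda>t. exp (\<mu> * t) * Re (cay \<sigma> z)) has_real_derivative \<mu> * Re (cay \<sigma> z)) (at 0 within {0..})"
    by (auto intro!: derivative_eq_intros)
  ultimately have "(h has_real_derivative Re (2 * \<sigma> * G z / (\<sigma> - z)\<^sup>2) - \<mu> * Re (cay \<sigma> z)) (at 0 within {0..})"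
    unfolding h_def by (rule DERIV_diff)
  then have lim: "((\<lambda>t. (h t - h 0) / (t - 0)) \<longlongrightarrow> Re (2 * \<sigma> * G z / (\<sigma> - z)\<^sup>2) - \<mu> * Re (cay \<sigma> z)) (at 0 within {0..})"
    by (simp add: has_field_derivative_iff)
  have "0 \<le> Re (2 * \<sigma> * G z / (\<sigma> - z)\<^sup>2) - \<mu> * Re (cay \<sigma> z)"
  proof (rule tendsto_lowerbound[OF lim])
    have "0 \<le> (h t - h 0) / (t - 0)" if "t > 0" for t
      using le[OF that] that by (simp add: h_def \<phi>0)
    then show "\<forall>\<^sub>F t in at 0 within {0..}. 0 \<le> (h t - h 0) / (t - 0)"
      by (auto simp: eventually_at_filter)
    show "at (0::real) within {0..} \<noteq> bot"
      by (simp add: at_within_Ici_at_right)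
  qed
  then show ?thesis by simp
qed

section \<open>Generators as reciprocals of functions with nonnegative real part\<close>

lemma beta_eqI:
  assumes "cmod \<tau> = 1" "angular_limit (\<lambda>z. (\<tau> - z) ^ 3 / (\<tau>\<^sup>2 * G z)) \<tau> L"
  shows "beta \<tau> G = L"
  unfolding beta_def by (rule the_equality) (use assms angular_limit_unique in blast)+

text \<open>In the Berkson--Porta formula \<open>G z = (\<tau> - z) * (1 - cnj \<tau> * z) * q z\<close> with
  \<open>Re (q z) \<ge> 0\<close>, this is \<open>1 / q\<close>: boundary fixed points of the semigroup are poles of \<open>1 / q\<close>.\<close>

definition bp :: "complex \<Rightarrow> (complex \<Rightarrow> complex) \<Rightarrow> complex \<Rightarrow> complex" where
  "bp \<tau> G z = (\<tau> - z) * (1 - cnj \<tau> * z) / G z"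

lemma bp_factor: "cmod \<tau> = 1 \<Longrightarrow> (\<tau> - z) * (1 - cnj \<tau> * z) = cnj \<tau> * (\<tau> - z)\<^sup>2"
  using cnj_unit[of \<tau>] by (simp add: algebra_simps power2_eq_square)

text \<open>By \<open>wolff\<close> the real part of \<open>cay \<tau>\<close> does not decrease
  along the flow, so its velocity q has Re q \<ge> 0, and bp = 2/q. A single zero of G would be a
  zero of q and force q = 0 everywhere by \<open>pick_const\<close>.\<close>

lemma berkson_porta:
  assumes \<phi>: "is_semigroup \<phi>" and G: "is_generator_of G \<phi>" and DW: "boundary_DW_point \<phi> \<tau>"
    and \<tau>: "cmod \<tau> = 1" and nz: "\<not> (\<forall>z\<in>unit_disc. G z = 0)"
  shows "\<And>z. z \<in> unit_disc \<Longrightarrow> G z \<noteq> 0" "bp \<tau> G holomorphic_on unit_disc"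
    "\<And>z. z \<in> unit_disc \<Longrightarrow> Re (bp \<tau> G z) \<ge> 0"
proof -
  have holG: "G holomorphic_on unit_disc" using G by (simp add: is_generator_of_def)
  define q where "q = (\<lambda>z. 2 * \<tau> * G z / (\<tau> - z)\<^sup>2)"
  have holq: "q holomorphic_on unit_disc"
    unfolding q_def by (intro holomorphic_intros holG) (use unit_disc_ne[OF \<tau>] in auto)
  have Req: "Re (q z) \<ge> 0" if "z \<in> unit_disc" for z
    using Re_generator_ge[OF \<phi> G \<tau> that, of 0] wolff[OF \<phi> DW \<tau> _ that] by (simp add: q_def)
  show Gnz: "G z \<noteq> 0" if z: "z \<in> unit_disc" for z
  proof
    assume "G z = 0"
    then have qz: "q z = 0" by (simp add: q_def)
    have "G w = 0" if w: "w \<in> unit_disc" for w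
    proof -
      have "q w = q z" by (rule pick_const[OF holq Req z _ w]) (simp_all add: qz)
      then show ?thesis using qz unit_disc_ne[OF \<tau> w] \<tau> by (auto simp: q_def)
    qed
    then show False using nz by blast
  qed
  show "bp \<tau> G holomorphic_on unit_disc"
    unfolding bp_def by (intro holomorphic_intros holG) (use Gnz in auto)
  show "Re (bp \<tau> G z) \<ge> 0" if z: "z \<in> unit_disc" for z
  proof -
    have "bp \<tau> G z = (cnj \<tau> * \<tau>) * 2 / q z"
      unfolding bp_def bp_factor[OF \<tau>] q_def using Gnz[OF z] unit_disc_ne[OF \<tau> z] \<tau> by (auto simp: field_simps)
    then have "bp \<tau> G z = 2 * inverse (q z)"
      using cnj_unit[OF \<tau>] by (simp add: mult.commute divide_inverse)
    then have "Re (bp \<tau> G z) = 2 * (Re (q z) / ((Re (q z))\<^sup>2 + (Im (q z))\<^sup>2))"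
      by simp
    then show ?thesis using Req[OF z] by simp
  qed
qed

text \<open>At \<open>\<sigma>\<close>, both \<open>G z / (\<sigma> - z)\<close> and \<open>(\<sigma> - z) * bp \<tau> G z\<close> have angular limits, and their product
  tends to \<open>- \<sigma> * \<bar>\<tau> - \<sigma>\<bar>\<^sup>2\<close>. The first limit is at least \<open>\<mu>\<close>; the second is \<open>2 * \<sigma>\<close> times the mass.\<close>

lemma mass_bp_ge:
  assumes \<phi>: "is_semigroup \<phi>" and G: "is_generator_of G \<phi>" and DW: "boundary_DW_point \<phi> \<tau>"
    and \<tau>: "cmod \<tau> = 1" and nz: "\<not> (\<forall>z\<in>unit_disc. G z = 0)"
    and \<sigma>: "cmod \<sigma> = 1" "\<sigma> \<noteq> \<tau>" and \<mu>: "BRFP_spectral \<phi> \<sigma> \<mu>" "\<Lambda> \<le> \<mu>" "\<Lambda> < 0"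
  shows "(cmod (\<tau> - \<sigma>))\<^sup>2 / (2 * \<bar>\<Lambda>\<bar>) \<le> mass (bp \<tau> G) \<sigma>"
proof -
  let ?p = "bp \<tau> G"
  note p = berkson_porta[OF \<phi> G DW \<tau> nz]
  have holG: "G holomorphic_on unit_disc" using G by (simp add: is_generator_of_def)
  \<comment> \<open>Julia's inequality, differentiated, says Re r \<ge> 0. So r has a mass mr \<ge>
    0 at \<sigma>, and G z / (\<sigma> - z) has the angular limit \<mu> + mr.\<close>
  define r where "r = (\<lambda>z. 2 * \<sigma> * G z / (\<sigma> - z)\<^sup>2 - of_real \<mu> * cay \<sigma> z)"
  have holr: "r holomorphic_on unit_disc"
    unfolding r_def by (intro holomorphic_intros holG holomorphic_cay \<sigma>) (use unit_disc_ne[OF \<sigma>(1)] in auto)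
  have Rer: "Re (r z) \<ge> 0" if z: "z \<in> unit_disc" for z
  proof -
    have "exp (\<mu> * t) * Re (cay \<sigma> z) \<le> Re (cay \<sigma> (\<phi> t z))" if t: "t > 0" for t
    proof -
      have "Re (cay \<sigma> z) \<le> exp (- \<mu> * t) * Re (cay \<sigma> (\<phi> t z))"
        by (rule julia) (use \<phi> \<mu>(1) t \<sigma> z in \<open>auto simp: is_semigroup_def BRFP_spectral_def\<close>)
      then have "exp (\<mu> * t) * Re (cay \<sigma> z) \<le> exp (\<mu> * t) * (exp (- \<mu> * t) * Re (cay \<sigma> (\<phi> t z)))"
        by (rule mult_left_mono) simp
      also have "\<dots> = Re (cay \<sigma> (\<phi> t z))"
        by (simp add: mult.assoc[symmetric] exp_add[symmetric])
      finally show ?thesis .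
    qed
    from Re_generator_ge[OF \<phi> G \<sigma>(1) z this] show ?thesis by (simp add: r_def)
  qed
  define m where "m = mass ?p \<sigma>"
  define mr where "mr = mass r \<sigma>"
  have m: "m \<ge> 0" unfolding m_def by (rule mass_nonneg[OF p(2,3) \<sigma>(1)])
  have mr: "mr \<ge> 0" unfolding mr_def by (rule mass_nonneg[OF holr Rer \<sigma>(1)])
  have "angular_limit (\<lambda>z. (\<sigma> - z) * r z) \<sigma> (2 * \<sigma> * of_real mr)"
    unfolding mr_def by (rule angular_limit_mass[OF holr Rer \<sigma>(1)])
  moreover have "angular_limit (\<lambda>z. - of_real \<mu> * (\<sigma> + z)) \<sigma> (- of_real \<mu> * (\<sigma> + \<sigma>))"
    by (intro tendsto_angular_limit tendsto_intros)
  ultimately have "angular_limit (\<lambda>z. (\<sigma> - z) * r z - - of_real \<mu> * (\<sigma> + z)) \<sigma>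
      (2 * \<sigma> * of_real mr - - of_real \<mu> * (\<sigma> + \<sigma>))"
    by (rule angular_limit_diff)
  moreover have "angular_limit (\<lambda>z. (\<sigma> - z) * ?p z) \<sigma> (2 * \<sigma> * of_real m)"
    unfolding m_def by (rule angular_limit_mass[OF p(2,3) \<sigma>(1)])
  ultimately have "angular_limit (\<lambda>z. ((\<sigma> - z) * r z - - of_real \<mu> * (\<sigma> + z)) * ((\<sigma> - z) * ?p z)) \<sigma>
      ((2 * \<sigma> * of_real mr - - of_real \<mu> * (\<sigma> + \<sigma>)) * (2 * \<sigma> * of_real m))"
    by (rule angular_limit_mult)
  \<comment> \<open>The first factor is 2 * \<sigma> * G z / (\<sigma> - z); in the product G and
    the pole both cancel, leaving a function continuous at \<sigma>.\<close>
  also have "?this \<longleftrightarrow> angular_limit (\<lambda>z. 2 * \<sigma> * (cnj \<tau> * (\<tau> - z)\<^sup>2)) \<sigma>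
      ((2 * \<sigma> * of_real mr - - of_real \<mu> * (\<sigma> + \<sigma>)) * (2 * \<sigma> * of_real m))"
  proof (rule angular_limit_cong)
    fix z assume z: "z \<in> unit_disc"
    have ne: "\<sigma> - z \<noteq> 0" by (rule unit_disc_ne[OF \<sigma>(1) z])
    have "(\<sigma> - z) * r z - - of_real \<mu> * (\<sigma> + z) = 2 * \<sigma> * G z / (\<sigma> - z)"
    proof -
      have "(\<sigma> - z) * (2 * \<sigma> * G z / (\<sigma> - z)\<^sup>2) = 2 * \<sigma> * G z / (\<sigma> - z)"
        using ne by (simp add: power2_eq_square)
      moreover have "(\<sigma> - z) * (of_real \<mu> * cay \<sigma> z) = of_real \<mu> * (\<sigma> + z)"
        using mult_cay[of z \<sigma>] ne by (simp add: mult.left_commute)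
      ultimately show ?thesis by (auto simp: r_def right_diff_distrib[of _ _ "of_real \<mu> * _"])
    qed
    then show "((\<sigma> - z) * r z - - of_real \<mu> * (\<sigma> + z)) * ((\<sigma> - z) * ?p z) = 2 * \<sigma> * (cnj \<tau> * (\<tau> - z)\<^sup>2)"
      using p(1)[OF z] ne by (simp add: bp_def bp_factor[OF \<tau>])
  qed
  finally have "(2 * \<sigma> * of_real mr - - of_real \<mu> * (\<sigma> + \<sigma>)) * (2 * \<sigma> * of_real m) = 2 * \<sigma> * (cnj \<tau> * (\<tau> - \<sigma>)\<^sup>2)"
    by (rule angular_limit_unique[OF \<sigma>(1)]) (intro tendsto_angular_limit tendsto_intros)
  moreover have "cnj \<tau> * (\<tau> - \<sigma>)\<^sup>2 = - \<sigma> * of_real ((cmod (\<tau> - \<sigma>))\<^sup>2)"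
    by (rule diff_sq_eq[OF \<tau> \<sigma>(1)])
  ultimately have "2 * \<sigma> * \<sigma> * of_real (2 * (mr + \<mu>) * m) = 2 * \<sigma> * \<sigma> * of_real (- ((cmod (\<tau> - \<sigma>))\<^sup>2))"
    by (simp add: algebra_simps)
  then have eq: "2 * (mr + \<mu>) * m = - ((cmod (\<tau> - \<sigma>))\<^sup>2)"
    using \<sigma>(1) by (simp only: mult_cancel_left of_real_eq_iff) auto
  have "(cmod (\<tau> - \<sigma>))\<^sup>2 = 2 * (- (mr + \<mu>)) * m" using eq by (simp add: algebra_simps)
  also have "\<dots> \<le> 2 * (- \<Lambda>) * m" using \<mu> m mr by (intro mult_right_mono) auto
  finally show ?thesis
    using \<mu>(3) by (subst pos_divide_le_eq) (auto simp: m_def mult.commute)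
qed

text \<open>Since cnj \<tau> = 1/\<tau>, the quotient in \<open>beta\<close> is (\<tau> - z) * bp
  \<tau> G z / \<tau>. The 2 is the value of (\<tau> + z)/\<tau> at \<tau>.\<close>

lemma angular_limit_beta:
  assumes \<tau>: "cmod \<tau> = 1" and G: "\<And>z. z \<in> unit_disc \<Longrightarrow> G z \<noteq> 0"
    and p: "bp \<tau> G holomorphic_on unit_disc" "\<And>z. z \<in> unit_disc \<Longrightarrow> Re (bp \<tau> G z) \<ge> 0"
  shows "beta \<tau> G = of_real (2 * mass (bp \<tau> G) \<tau>)"
proof (rule beta_eqI[OF \<tau>])
  have \<tau>0: "\<tau> \<noteq> 0" using \<tau> by auto
  have "angular_limit (\<lambda>z. (\<tau> - z) * bp \<tau> G z) \<tau> (2 * \<tau> * of_real (mass (bp \<tau> G) \<tau>))"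
    by (rule angular_limit_mass[OF p \<tau>])
  moreover have "angular_limit (\<lambda>_. \<tau>) \<tau> \<tau>" by (simp add: angular_limit_def)
  ultimately have "angular_limit (\<lambda>z. (\<tau> - z) * bp \<tau> G z / \<tau>) \<tau> (2 * \<tau> * of_real (mass (bp \<tau> G) \<tau>) / \<tau>)"
    using \<tau>0 by (intro angular_limit_divide)
  moreover have "(\<tau> - z) * bp \<tau> G z / \<tau> = (\<tau> - z) ^ 3 / (\<tau>\<^sup>2 * G z)" for z
  proof -
    have "cnj \<tau> = inverse \<tau>" using cnj_unit[OF \<tau>] by (simp add: inverse_unique)
    then show ?thesis
      using \<tau>0 by (simp add: bp_def bp_factor[OF \<tau>] power2_eq_square power3_eq_cube divide_simps)
  qed
  ultimately show "angular_limit (\<lambda>z. (\<tau> - z) ^ 3 / (\<tau>\<^sup>2 * G z)) \<tau> (of_real (2 * mass (bp \<tau> G) \<tau>))"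
    using \<tau>0 by simp
qed

section \<open>Existence of the flow\<close>

text \<open>The Noshiro-Warschawski criterion: on the segment from a to b the real part of f / (b -
  a) has derivative Re f' > 0, so it takes different values at the ends.\<close>

lemma inj_on_Re_deriv_pos:
  fixes f :: "complex \<Rightarrow> complex"
  assumes "convex S"
    and der: "\<And>z. z \<in> S \<Longrightarrow> (f has_field_derivative f' z) (at z)"
    and pos: "\<And>z. z \<in> S \<Longrightarrow> Re (f' z) > 0"
  shows "inj_on f S"
proof (rule inj_onI, rule ccontr)
  fix a b assume ab: "a \<in> S" "b \<in> S" "f a = f b" "a \<noteq> b"
  define l where "l = (\<lambda>t::real. a + of_real t * (b - a))"
  have l: "l t \<in> S" if "0 \<le> t" "t \<le> 1" for t
    using convexD_alt[OF assms(1) ab(1,2) that] by (simp add: l_def algebra_simps scaleR_conv_of_real)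
  have der_l: "((\<lambda>t. Re (f (l t) / (b - a))) has_real_derivative Re (f' (l t))) (at t)" if "0 \<le> t" "t \<le> 1" for t
  proof -
    have "(l has_vector_derivative (b - a)) (at t)"
      unfolding l_def by (auto intro!: derivative_eq_intros)
    then have "((f \<circ> l) has_vector_derivative (b - a) * f' (l t)) (at t)"
      by (rule field_vector_diff_chain_at) (rule der[OF l[OF that]])
    then have "((\<lambda>t. Re ((f \<circ> l) t / (b - a))) has_vector_derivative Re ((b - a) * f' (l t) / (b - a))) (at t)"
      by (intro bounded_linear.has_vector_derivative[OF bounded_linear_Re] has_vector_derivative_divide)
    then show ?thesis using ab(4) by (simp add: has_real_derivative_iff_has_vector_derivative o_def)
  qed
  have "Re (f (l 0) / (b - a)) < Re (f (l 1) / (b - a))"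
    by (rule DERIV_pos_imp_increasing[of 0 1]) (simp, use der_l pos[OF l] in blast)
  then show False using ab(3) by (simp add: l_def)
qed

section \<open>The global flow in the right half-plane\<close>

abbreviation rhp :: "complex set" where
  "rhp \<equiv> {w. Re w > 0}"

text \<open>Trajectories never move left, so a bound on the modulus confines them to such a set; d >
  0 keeps it off the imaginary axis.\<close>

lemma compact_rhp_piece: "compact {w. Re w \<ge> d \<and> cmod w \<le> R}"
proof -
  have "{w. Re w \<ge> d \<and> cmod w \<le> R} = {w. Re w \<ge> d} \<inter> cball 0 R" by auto
  then show ?thesis by (simp add: closed_halfspace_Re_ge closed_Int_compact)
qed

text \<open>The flow is \<open>w \<mapsto> Q\<^sup>-\<^sup>1 (Q w + t)\<close> for a primitive \<open>Q\<close> of \<open>P\<close>, which is univalent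
  because \<open>Re P > 0\<close>. Along the flow
  \<open>ln \<bar>w + 1\<bar> - ln (Re w) / 2 - t / (2 * c)\<close> does not increase, so no trajectory escapes
  to infinity in finite time.\<close>

lemma rhp_flow:
  assumes hol: "P holomorphic_on rhp" and c: "c > 0"
    and lower: "\<And>w. w \<in> rhp \<Longrightarrow> c * Re w / (cmod (w + 1))\<^sup>2 \<le> Re (P w)"
  obtains \<Phi> where
    "\<And>t. t \<ge> 0 \<Longrightarrow> \<Phi> t holomorphic_on rhp"
    "\<And>t w. t \<ge> 0 \<Longrightarrow> w \<in> rhp \<Longrightarrow> \<Phi> t w \<in> rhp"
    "\<And>w. w \<in> rhp \<Longrightarrow> \<Phi> 0 w = w"
    "\<And>s t w. s \<ge> 0 \<Longrightarrow> t \<ge> 0 \<Longrightarrow> w \<in> rhp \<Longrightarrow> \<Phi> s (\<Phi> t w) = \<Phi> (s + t) w"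
    "\<And>t w. t \<ge> 0 \<Longrightarrow> w \<in> rhp \<Longrightarrow> ((\<lambda>s. \<Phi> s w) has_vector_derivative 1 / P (\<Phi> t w)) (at t)"
    "\<And>w. w \<in> rhp \<Longrightarrow> filterlim (\<lambda>t. \<Phi> t w) at_infinity at_top"
proof -
  have opn: "open rhp" by (rule open_halfspace_Re_gt)
  have cvx: "convex rhp" by (rule convex_halfspace_Re_gt)
  have ne1: "w + 1 \<noteq> 0" if "w \<in> rhp" for w
    using that by (auto simp: complex_eq_iff)
  have Ppos: "Re (P w) > 0" if w: "w \<in> rhp" for w
  proof -
    have "0 < c * Re w / (cmod (w + 1))\<^sup>2" using c w ne1[OF w] by simp
    with lower[OF w] show ?thesis by linarith
  qed
  obtain Q where Q0: "\<And>w. w \<in> rhp \<Longrightarrow> (Q has_field_derivative P w) (at w within rhp)"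
    using holomorphic_convex_primitive'[OF cvx opn hol] by blast
  have Q: "(Q has_field_derivative P w) (at w)" if "w \<in> rhp" for w
    using Q0[OF that] that by (simp add: at_within_open[OF _ opn])
  have holQ: "Q holomorphic_on rhp"
    using Q opn by (auto simp: holomorphic_on_open)
  have inj: "inj_on Q rhp"
    by (rule inj_on_Re_deriv_pos[OF cvx Q Ppos])
  obtain g where holg: "g holomorphic_on Q ` rhp"
    and dg: "\<And>w. w \<in> rhp \<Longrightarrow> deriv Q w * deriv g (Q w) = 1" and gQ: "\<And>w. w \<in> rhp \<Longrightarrow> g (Q w) = w"
    using holomorphic_has_inverse[OF holQ opn inj] by blast
  have opnU: "open (Q ` rhp)"
    by (rule open_mapping_thm3[OF holQ opn inj])
  have Qg: "g u \<in> rhp \<and> Q (g u) = u" if "u \<in> Q ` rhp" for u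
    using that gQ by auto
  have derg: "(g has_field_derivative 1 / P (g u)) (at u)" if u: "u \<in> Q ` rhp" for u
  proof -
    have gu: "g u \<in> rhp" and Qgu: "Q (g u) = u" using Qg[OF u] by auto
    have "deriv Q (g u) = P (g u)" using Q[OF gu] by (rule DERIV_imp_deriv)
    then have "P (g u) * deriv g u = 1" using dg[OF gu] Qgu by simp
    then have "deriv g u = 1 / P (g u)"
      by (metis mult.commute mult_zero_left nonzero_eq_divide_eq zero_neq_one)
    then show ?thesis using holomorphic_derivI[OF holg opnU u] by simp
  qed
  have dery: "((\<lambda>s. g (Q w + of_real s)) has_vector_derivative 1 / P (g (Q w + of_real t))) (at t)"
    if "Q w + of_real t \<in> Q ` rhp" for w t
  proof -
    have "((\<lambda>s. Q w + of_real s) has_vector_derivative 1) (at t)"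
      by (auto intro!: derivative_eq_intros)
    from field_vector_diff_chain_at[OF this derg[OF that]] show ?thesis by (simp add: o_def)
  qed
  have mono: "Re w \<le> Re (g (Q w + of_real t))"
    if w: "w \<in> rhp" and t: "t \<ge> 0" and U: "\<And>s. 0 \<le> s \<Longrightarrow> s \<le> t \<Longrightarrow> Q w + of_real s \<in> Q ` rhp" for w t
  proof -
    have "Re (g (Q w + of_real 0)) \<le> Re (g (Q w + of_real t))"
    proof (rule DERIV_nonneg_imp_nondecreasing[OF t])
      fix s assume s: "0 \<le> s" "s \<le> t"
      have "((\<lambda>s. Re (g (Q w + of_real s))) has_real_derivative Re (1 / P (g (Q w + of_real s)))) (at s)"
        using bounded_linear.has_vector_derivative[OF bounded_linear_Re dery[OF U[OF s]]]
        by (simp add: has_real_derivative_iff_has_vector_derivative)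
      moreover have "Re (P (g (Q w + of_real s))) > 0"
        using Ppos Qg[OF U[OF s]] by blast
      then have "Re (1 / P (g (Q w + of_real s))) \<ge> 0"
        by (simp add: Re_divide)
      ultimately show "\<exists>y. ((\<lambda>s. Re (g (Q w + of_real s))) has_real_derivative y) (at s) \<and> 0 \<le> y" by blast
    qed
    then show ?thesis using gQ[OF w] by simp
  qed
  have bounded: "cmod (g (Q w + of_real t)) \<le> exp (t / c + 2 * ln (cmod (w + 1)) - ln (Re w)) + 1"
    if w: "w \<in> rhp" and t: "t \<ge> 0" and U: "\<And>s. 0 \<le> s \<Longrightarrow> s \<le> t \<Longrightarrow> Q w + of_real s \<in> Q ` rhp" for w t
  proof -
    define y where "y = (\<lambda>s::real. g (Q w + of_real s))"
    define A where "A = (\<lambda>s. Re (Ln (y s + 1)) - ln (Re (y s)) / 2 - s / (2 * c))"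
    have y: "y s \<in> rhp" if "0 \<le> s" "s \<le> t" for s
      using Qg[OF U[OF that]] by (simp add: y_def)
    have "A t \<le> A 0"
    proof (rule DERIV_nonpos_imp_nonincreasing[OF t])
      fix s assume s: "0 \<le> s" "s \<le> t"
      define V where "V = 1 / P (y s)"
      have ys: "Re (y s) > 0" using y[OF s] by simp
      have dy: "(y has_vector_derivative V) (at s)"
        unfolding y_def V_def by (rule dery[OF U[OF s]])
      have dRe: "((\<lambda>s. Re (y s)) has_real_derivative Re V) (at s)"
        using bounded_linear.has_vector_derivative[OF bounded_linear_Re dy]
        by (simp add: has_real_derivative_iff_has_vector_derivative)
      have "((\<lambda>s. y s + 1) has_vector_derivative V) (at s)"
        using dy by (auto intro!: derivative_eq_intros)
      moreover have "(Ln has_field_derivative inverse (y s + 1)) (at (y s + 1))"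
        by (rule has_field_derivative_Ln) (use ys in \<open>auto simp: complex_nonpos_Reals_iff\<close>)
      ultimately have "((Ln \<circ> (\<lambda>s. y s + 1)) has_vector_derivative V * inverse (y s + 1)) (at s)"
        by (rule field_vector_diff_chain_at)
      then have "((\<lambda>s. Re (Ln (y s + 1))) has_real_derivative Re (V / (y s + 1))) (at s)"
        using bounded_linear.has_vector_derivative[OF bounded_linear_Re]
        by (fastforce simp: has_real_derivative_iff_has_vector_derivative o_def divide_inverse)
      moreover have "((\<lambda>s. ln (Re (y s)) / 2 + s / (2 * c)) has_real_derivative Re V / Re (y s) / 2 + 1 / (2 * c)) (at s)"
        using DERIV_add[OF DERIV_cdivide[OF DERIV_chain2[OF DERIV_ln_divide[OF ys] dRe]] DERIV_cdivide[OF DERIV_ident]]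
        by simp
      ultimately have "((\<lambda>s. Re (Ln (y s + 1)) - (ln (Re (y s)) / 2 + s / (2 * c))) has_real_derivative
          Re (V / (y s + 1)) - (Re V / Re (y s) / 2 + 1 / (2 * c))) (at s)"
        by (rule DERIV_diff)
      then have "(A has_real_derivative Re (V / (y s + 1)) - (Re V / Re (y s) / 2 + 1 / (2 * c))) (at s)"
        by (simp add: A_def diff_diff_eq)
      moreover have "Re (V / (y s + 1)) \<le> Re V / Re (y s) / 2 + 1 / (2 * c)"
      proof -
        \<comment> \<open>\<open>lower\<close> becomes c * X^2 \<le> Y, and the arithmetic-geometric
          mean inequality bounds sqrt (Y / c) by Y/2 + 1/(2c). This dictates the coefficients in
          \<open>A\<close>.\<close>
        define X where "X = cmod (V / (y s + 1))"
        define Y where "Y = Re V / Re (y s)"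
        have RP: "Re (P (y s)) > 0" by (rule Ppos[OF y[OF s]])
        then have nP: "cmod (P (y s)) > 0" by force
        have ReV: "Re V = Re (P (y s)) / (cmod (P (y s)))\<^sup>2"
          by (simp add: V_def Re_divide cmod_power2)
        have Y0: "Y \<ge> 0" using RP ys by (simp add: Y_def ReV)
        have n1: "cmod (y s + 1) > 0" using ne1[OF y[OF s]] by simp
        have "c * X\<^sup>2 = c / (cmod (y s + 1))\<^sup>2 * (1 / (cmod (P (y s)))\<^sup>2)"
          by (simp add: X_def V_def norm_divide power_divide norm_mult power_mult_distrib)
        also have "\<dots> \<le> Re (P (y s)) / Re (y s) * (1 / (cmod (P (y s)))\<^sup>2)"
          using lower[OF y[OF s]] ys by (intro mult_right_mono) (auto simp: field_simps)
        also have "\<dots> = Y" by (simp add: Y_def ReV)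
        finally have "X\<^sup>2 \<le> Y / c" using c by (simp add: field_simps)
        also have "\<dots> \<le> (Y / 2 + 1 / (2 * c))\<^sup>2"
          using zero_le_power2[of "Y / 2 - 1 / (2 * c)"] by (simp add: power2_eq_square algebra_simps)
        finally have "X \<le> Y / 2 + 1 / (2 * c)"
          by (rule power2_le_imp_le) (use Y0 c in simp)
        then show ?thesis using complex_Re_le_cmod[of "V / (y s + 1)"] by (simp add: X_def Y_def)
      qed
      ultimately show "\<exists>d. (A has_real_derivative d) (at s) \<and> d \<le> 0" by fastforce
    qed
    moreover have y0: "y 0 = w" using gQ[OF w] by (simp add: y_def)
    moreover have yt: "Re (y t) > 0" using y[of t] t by simp
    \<comment> \<open>So A t is at least half of ln |y t + 1| minus t/(2c); doubling A t \<le> A 0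
      gives the exponent in the claim.\<close>
    have "ln (Re (y t)) \<le> ln (cmod (y t + 1))"
      using yt complex_Re_le_cmod[of "y t + 1"] by (subst ln_le_cancel_iff) auto
    moreover have nyt: "y t + 1 \<noteq> 0" by (rule ne1) (use yt in simp)
    moreover have "Re (Ln (y t + 1)) = ln (cmod (y t + 1))" "Re (Ln (w + 1)) = ln (cmod (w + 1))"
      by (rule Re_Ln[OF nyt], rule Re_Ln[OF ne1[OF w]])
    ultimately have "ln (cmod (y t + 1)) \<le> t / c + 2 * ln (cmod (w + 1)) - ln (Re w)"
      by (simp add: A_def)
    then have "cmod (y t + 1) \<le> exp (t / c + 2 * ln (cmod (w + 1)) - ln (Re w))"
      using nyt by (metis exp_le_cancel_iff exp_ln zero_less_norm_iff)
    moreover have "cmod (y t) \<le> cmod (y t + 1) + 1"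
      by (metis add_diff_cancel_right' norm_one norm_triangle_ineq4)
    ultimately show ?thesis by (simp add: y_def)
  qed
  have U: "Q w + of_real t \<in> Q ` rhp" if w: "w \<in> rhp" and t: "t \<ge> 0" for w t
  proof (rule ccontr)
    assume nU: "Q w + of_real t \<notin> Q ` rhp"
    \<comment> \<open>The times at which the translate is outside the image of Q. This set is closed
      because the image is open, so there is a first exit time T.\<close>
    define B where "B = {0..} \<inter> (\<lambda>s::real. Q w + of_real s) -` (- Q ` rhp)"
    have "closed B"
      unfolding B_def using opnU
      by (intro closed_Int closed_vimage) (auto intro!: continuous_intros)
    moreover have "B \<noteq> {}" using nU t by (auto simp: B_def)
    moreover have bdd: "bdd_below B" by (rule bdd_belowI[of _ 0]) (simp add: B_def)
    ultimately have TB: "Inf B \<in> B" by (intro closed_contains_Inf)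
    define T where "T = Inf B"
    have T0: "T \<ge> 0" and TnU: "Q w + of_real T \<notin> Q ` rhp" using TB by (auto simp: B_def T_def)
    have below: "Q w + of_real s \<in> Q ` rhp" if "0 \<le> s" "s < T" for s
    proof (rule ccontr)
      assume "\<not> ?thesis"
      then have "s \<in> B" using that by (simp add: B_def)
      then have "T \<le> s" unfolding T_def by (rule cInf_lower[OF _ bdd])
      then show False using that by simp
    qed
    have "T \<noteq> 0" using TnU w by auto
    then have T: "T > 0" using T0 by simp
    \<comment> \<open>Up to time T the trajectory stays in this compact subset of
      \<open>rhp\<close>. Its image under Q is closed, so it also contains the limit at T, which
      contradicts the exit.\<close>
    define K where "K = {v. Re v \<ge> Re w \<and> cmod v \<le> exp (T / c + 2 * ln (cmod (w + 1)) - ln (Re w)) + 1}"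
    have K: "compact K" unfolding K_def by (rule compact_rhp_piece)
    have Krhp: "K \<subseteq> rhp" using w by (auto simp: K_def)
    have "Q w + of_real s \<in> Q ` K" if s: "0 < s" "s < T" for s
    proof -
      have Us: "Q w + of_real r \<in> Q ` rhp" if "0 \<le> r" "r \<le> s" for r
        using below[of r] that s by auto
      have "cmod (g (Q w + of_real s)) \<le> exp (s / c + 2 * ln (cmod (w + 1)) - ln (Re w)) + 1"
        by (rule bounded[OF w _ Us]) (use s in auto)
      also have "\<dots> \<le> exp (T / c + 2 * ln (cmod (w + 1)) - ln (Re w)) + 1"
        using s c by (simp add: divide_right_mono)
      finally have "g (Q w + of_real s) \<in> K"
        using mono[OF w _ Us] s by (auto simp: K_def)
      moreover have "Q (g (Q w + of_real s)) = Q w + of_real s" using Qg[OF Us[of s]] s by simp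
      ultimately show ?thesis by (metis imageI)
    qed
    then have "\<forall>\<^sub>F s in at_left T. Q w + of_real s \<in> Q ` K"
      by (intro eventually_at_leftI[OF _ T]) auto
    moreover have "compact (Q ` K)"
      using holomorphic_on_imp_continuous_on[OF holQ] Krhp K
      by (blast intro: compact_continuous_image continuous_on_subset)
    then have "closed (Q ` K)" by (rule compact_imp_closed)
    moreover have "((\<lambda>s. Q w + of_real s) \<longlongrightarrow> Q w + of_real T) (at_left T)"
      by (intro tendsto_intros)
    ultimately have "Q w + of_real T \<in> Q ` K"
      by (intro Lim_in_closed_set[of _ _ "at_left T"]) auto
    then show False using TnU Krhp by blast
  qed
  define \<Phi> where "\<Phi> = (\<lambda>t w. g (Q w + of_real t))"
  have in_rhp: "\<Phi> t w \<in> rhp" and Q\<Phi>: "Q (\<Phi> t w) = Q w + of_real t" if "t \<ge> 0" "w \<in> rhp" for t w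
    using Qg[OF U[OF that(2,1)]] by (simp_all add: \<Phi>_def)
  show thesis
  proof
    show "\<Phi> t holomorphic_on rhp" if t: "t \<ge> 0" for t
    proof -
      have "(\<lambda>w. Q w + of_real t) holomorphic_on rhp" by (intro holomorphic_intros holQ)
      moreover have "(\<lambda>w. Q w + of_real t) ` rhp \<subseteq> Q ` rhp" using U t by blast
      ultimately have "g \<circ> (\<lambda>w. Q w + of_real t) holomorphic_on rhp"
        by (intro holomorphic_on_compose_gen[OF _ holg])
      then show ?thesis by (simp add: \<Phi>_def o_def)
    qed
    show "\<Phi> t w \<in> rhp" if "t \<ge> 0" "w \<in> rhp" for t w by (rule in_rhp[OF that])
    show "\<Phi> 0 w = w" if "w \<in> rhp" for w using gQ[OF that] by (simp add: \<Phi>_def)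
    show "\<Phi> s (\<Phi> t w) = \<Phi> (s + t) w" if "s \<ge> 0" "t \<ge> 0" "w \<in> rhp" for s t w
      using Q\<Phi>[OF that(2,3)] by (simp add: \<Phi>_def add_ac)
    show "((\<lambda>s. \<Phi> s w) has_vector_derivative 1 / P (\<Phi> t w)) (at t)" if "t \<ge> 0" "w \<in> rhp" for t w
      unfolding \<Phi>_def by (rule dery[OF U[OF that(2,1)]])
    show "filterlim (\<lambda>t. \<Phi> t w) at_infinity at_top" if w: "w \<in> rhp" for w
      unfolding filterlim_at_infinity[OF order_refl]
    proof safe
      fix r :: real assume "r > 0"
      \<comment> \<open>As the real part never decreases, a trajectory point of modulus below r lies
        in K. There Q is bounded, while Q along the trajectory is \<open>Q w + t\<close>.\<close>
      define K where "K = {v. Re v \<ge> Re w \<and> cmod v \<le> r}"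
      have "K \<subseteq> rhp" using w by (auto simp: K_def)
      then have "continuous_on K Q"
        using holomorphic_on_imp_continuous_on[OF holQ] continuous_on_subset by blast
      then have "compact (Q ` K)"
        unfolding K_def by (intro compact_continuous_image compact_rhp_piece)
      then obtain b where b: "\<And>u. u \<in> Q ` K \<Longrightarrow> cmod u \<le> b"
        by (meson compact_imp_bounded bounded_iff)
      have "r \<le> cmod (\<Phi> t w)" if t: "t \<ge> max 0 (b + cmod (Q w) + 1)" for t
      proof (rule ccontr)
        assume "\<not> ?thesis"
        moreover have "Re w \<le> Re (\<Phi> t w)"
          unfolding \<Phi>_def using t by (intro mono[OF w] U[OF w]) auto
        ultimately have "Q (\<Phi> t w) \<in> Q ` K" by (auto simp: K_def)
        then have "cmod (Q w + of_real t) \<le> b" using b Q\<Phi>[OF _ w, of t] t by auto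
        moreover have "cmod (of_real t) \<le> cmod (Q w + of_real t) + cmod (Q w)"
          by (metis add.commute add_diff_cancel_left' norm_triangle_ineq4)
        ultimately show False using t by simp
      qed
      then show "\<forall>\<^sub>F t in at_top. r \<le> cmod (\<Phi> t w)"
        by (meson eventually_at_top_linorder)
    qed
  qed
qed

section \<open>Transfer of the flow to the disc\<close>

definition icay :: "complex \<Rightarrow> complex \<Rightarrow> complex" where
  "icay \<tau> w = \<tau> * (w - 1) / (w + 1)"

lemma diff_icay: "w \<in> rhp \<Longrightarrow> \<tau> - icay \<tau> w = 2 * \<tau> / (w + 1)"
  by (simp add: icay_def field_simps complex_eq_iff)

lemma rhp_add_1_ne: "w \<in> rhp \<Longrightarrow> w + 1 \<noteq> 0"
  by (auto simp: complex_eq_iff)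

lemma cay_icay:
  assumes "cmod \<tau> = 1" "w \<in> rhp" shows "cay \<tau> (icay \<tau> w) = w"
proof -
  have "w + 1 \<noteq> 0" by (rule rhp_add_1_ne[OF assms(2)])
  moreover have "\<tau> + icay \<tau> w = 2 * \<tau> * w / (w + 1)"
    using \<open>w + 1 \<noteq> 0\<close> by (simp add: icay_def divide_simps) (simp add: algebra_simps)
  moreover have "\<tau> \<noteq> 0" using assms by auto
  ultimately show ?thesis by (simp add: cay_def diff_icay[OF assms(2)])
qed

lemma icay_cay:
  assumes "\<tau> \<noteq> 0" "z \<noteq> \<tau>" shows "icay \<tau> (cay \<tau> z) = z"
proof -
  have "cay \<tau> z - 1 = 2 * z / (\<tau> - z)" "cay \<tau> z + 1 = 2 * \<tau> / (\<tau> - z)"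
    using assms by (simp_all add: cay_def divide_simps)
  then show ?thesis using assms by (simp add: icay_def)
qed

text \<open>\<open>Re_cay\<close> read in the half-plane coordinate. It produces the quantity Re w /
  |w + 1|^2 in which \<open>rhp_flow\<close> states its lower bound.\<close>

lemma one_minus_icay_sq:
  assumes "cmod \<tau> = 1" "w \<in> rhp" shows "1 - (cmod (icay \<tau> w))\<^sup>2 = 4 * (Re w / (cmod (w + 1))\<^sup>2)"
proof -
  have ne: "\<tau> - icay \<tau> w \<noteq> 0"
    using assms(1) rhp_add_1_ne[OF assms(2)] by (auto simp: diff_icay[OF assms(2)])
  have "Re w = (1 - (cmod (icay \<tau> w))\<^sup>2) / (cmod (\<tau> - icay \<tau> w))\<^sup>2"
    using Re_cay[OF assms(1), of "icay \<tau> w"] ne cay_icay[OF assms] by auto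
  then have "1 - (cmod (icay \<tau> w))\<^sup>2 = Re w * (cmod (\<tau> - icay \<tau> w))\<^sup>2"
    using ne by simp
  then show ?thesis
    by (simp add: diff_icay[OF assms(2)] norm_divide norm_mult assms(1) power_divide)
qed

lemma icay_in_unit_disc:
  assumes "cmod \<tau> = 1" "w \<in> rhp" shows "icay \<tau> w \<in> unit_disc"
proof -
  have "1 - (cmod (icay \<tau> w))\<^sup>2 > 0"
    unfolding one_minus_icay_sq[OF assms] using assms rhp_add_1_ne[OF assms(2)] by simp
  then show ?thesis by (simp add: abs_square_less_1)
qed

lemma holomorphic_icay: "icay \<tau> holomorphic_on rhp"
  unfolding icay_def by (intro holomorphic_intros) (use rhp_add_1_ne in auto)

lemma DERIV_icay: "w \<in> rhp \<Longrightarrow> (icay \<tau> has_field_derivative 2 * \<tau> / (w + 1)\<^sup>2) (at w within S)"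
  unfolding icay_def using rhp_add_1_ne[of w]
  by (auto intro!: derivative_eq_intros simp: power2_eq_square algebra_simps)

text \<open>Pick at a = 0, with |p z + cnj (p 0)| bounded below by its real part and hence by Re (p
  0). It supplies the hypothesis \<open>lower\<close> of \<open>rhp_flow\<close>.\<close>

lemma harnack_lower:
  assumes "p holomorphic_on unit_disc" "\<And>z. z \<in> unit_disc \<Longrightarrow> Re (p z) > 0" "z \<in> unit_disc"
  shows "(1 - (cmod z)\<^sup>2) * Re (p 0) \<le> 4 * Re (p z)"
proof -
  have p0: "Re (p 0) > 0" and pz: "Re (p z) > 0" using assms by auto
  have "Re (p 0) \<le> Re (p z + cnj (p 0))" using pz by simp
  also have "\<dots> \<le> cmod (p z + cnj (p 0))" by (rule complex_Re_le_cmod)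
  finally have "(Re (p 0))\<^sup>2 \<le> (cmod (p z + cnj (p 0)))\<^sup>2"
    using p0 by (intro power_mono) auto
  then have "(1 - (cmod z)\<^sup>2) * (Re (p 0))\<^sup>2 \<le> (1 - (cmod z)\<^sup>2) * (cmod (p z + cnj (p 0)))\<^sup>2"
    using unit_disc_sq_lt[OF assms(3)] by (intro mult_left_mono) auto
  also have "\<dots> \<le> 4 * Re (p z) * Re (p 0)"
    using pick_pos[OF assms, of 0] by simp
  finally have "Re (p 0) * ((1 - (cmod z)\<^sup>2) * Re (p 0)) \<le> Re (p 0) * (4 * Re (p z))"
    by (simp add: power2_eq_square ac_simps)
  then show ?thesis using p0 by (rule mult_left_le_imp_le)
qed

text \<open>Conjugating by \<open>cay \<tau>\<close> sends \<tau> to infinity, so divergence of the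
  half-plane trajectories is the Denjoy-Wolff property.\<close>

lemma generation:
  assumes hol: "p holomorphic_on unit_disc" and Rep: "\<And>z. z \<in> unit_disc \<Longrightarrow> Re (p z) > 0"
    and \<tau>: "cmod \<tau> = 1"
  obtains \<phi> where "is_semigroup \<phi>" "is_generator_of (\<lambda>z. (\<tau> - z) * (1 - cnj \<tau> * z) / p z) \<phi>"
    "boundary_DW_point \<phi> \<tau>"
proof -
  define P where "P = (\<lambda>w. p (icay \<tau> w) / 2)"
  \<comment> \<open>The 4 of \<open>harnack_lower\<close> cancels against the 4 of
    \<open>one_minus_icay_sq\<close>; the half comes from \<open>P\<close>.\<close>
  define c where "c = Re (p 0) / 2"
  have \<tau>0: "\<tau> \<noteq> 0" using \<tau> by auto
  have "p \<circ> icay \<tau> holomorphic_on rhp"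
    by (rule holomorphic_on_compose_gen[OF holomorphic_icay hol]) (use icay_in_unit_disc[OF \<tau>] in blast)
  then have "(\<lambda>w. p (icay \<tau> w)) holomorphic_on rhp" by (simp add: o_def)
  then have holP: "P holomorphic_on rhp"
    unfolding P_def by (intro holomorphic_intros) auto
  have c: "c > 0" using Rep[of 0] by (simp add: c_def)
  have lower: "c * Re w / (cmod (w + 1))\<^sup>2 \<le> Re (P w)" if w: "w \<in> rhp" for w
  proof -
    have "4 * (Re w / (cmod (w + 1))\<^sup>2) * Re (p 0) \<le> 4 * Re (p (icay \<tau> w))"
      using harnack_lower[OF hol Rep icay_in_unit_disc[OF \<tau> w]]
      unfolding one_minus_icay_sq[OF \<tau> w] .
    then have "Re w / (cmod (w + 1))\<^sup>2 * Re (p 0) \<le> Re (p (icay \<tau> w))" by linarith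
    then show ?thesis by (simp add: P_def c_def mult.commute)
  qed
  obtain \<Phi> where \<Phi>:
    "\<And>t. t \<ge> 0 \<Longrightarrow> \<Phi> t holomorphic_on rhp"
    "\<And>t w. t \<ge> 0 \<Longrightarrow> w \<in> rhp \<Longrightarrow> \<Phi> t w \<in> rhp"
    "\<And>w. w \<in> rhp \<Longrightarrow> \<Phi> 0 w = w"
    "\<And>s t w. s \<ge> 0 \<Longrightarrow> t \<ge> 0 \<Longrightarrow> w \<in> rhp \<Longrightarrow> \<Phi> s (\<Phi> t w) = \<Phi> (s + t) w"
    "\<And>t w. t \<ge> 0 \<Longrightarrow> w \<in> rhp \<Longrightarrow> ((\<lambda>s. \<Phi> s w) has_vector_derivative 1 / P (\<Phi> t w)) (at t)"
    "\<And>w. w \<in> rhp \<Longrightarrow> filterlim (\<lambda>t. \<Phi> t w) at_infinity at_top"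
    using rhp_flow[OF holP c lower] by blast
  define \<phi> where "\<phi> = (\<lambda>t z. icay \<tau> (\<Phi> t (cay \<tau> z)))"
  have cay_in: "cay \<tau> z \<in> rhp" if "z \<in> unit_disc" for z
    using Re_cay_pos[OF \<tau> that] by simp
  have \<Phi>_in: "\<Phi> t (cay \<tau> z) \<in> rhp" if "t \<ge> 0" "z \<in> unit_disc" for t z
    by (rule \<Phi>(2)[OF that(1) cay_in[OF that(2)]])
  have in_disc: "\<phi> t z \<in> unit_disc" if "t \<ge> 0" "z \<in> unit_disc" for t z
    unfolding \<phi>_def by (rule icay_in_unit_disc[OF \<tau> \<Phi>_in[OF that]])
  have cay\<phi>: "cay \<tau> (\<phi> t z) = \<Phi> t (cay \<tau> z)" if "t \<ge> 0" "z \<in> unit_disc" for t z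
    unfolding \<phi>_def by (rule cay_icay[OF \<tau> \<Phi>_in[OF that]])
  have \<phi>0: "\<phi> 0 z = z" if "z \<in> unit_disc" for z
    using icay_cay[OF \<tau>0, of z] unit_disc_ne[OF \<tau> that] \<Phi>(3)[OF cay_in[OF that]] by (auto simp: \<phi>_def)
  let ?G = "\<lambda>z. (\<tau> - z) * (1 - cnj \<tau> * z) / p z"
  have der: "((\<lambda>s. \<phi> s z) has_vector_derivative ?G (\<phi> t z)) (at t)" if tz: "t \<ge> 0" "z \<in> unit_disc" for t z
  proof -
    define w where "w = \<Phi> t (cay \<tau> z)"
    have w: "w \<in> rhp" unfolding w_def by (rule \<Phi>_in[OF tz])
    have \<phi>w: "\<phi> t z = icay \<tau> w" by (simp add: \<phi>_def w_def)
    have "((icay \<tau> \<circ> (\<lambda>s. \<Phi> s (cay \<tau> z))) has_vector_derivative 1 / P w * (2 * \<tau> / (w + 1)\<^sup>2)) (at t)"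
      unfolding w_def
      by (rule field_vector_diff_chain_at[OF \<Phi>(5)[OF tz(1) cay_in[OF tz(2)]] DERIV_icay[OF \<Phi>_in[OF tz]]])
    moreover have "1 / P w * (2 * \<tau> / (w + 1)\<^sup>2) = ?G (\<phi> t z)"
    proof -
      have "p (icay \<tau> w) \<noteq> 0" using Rep[OF icay_in_unit_disc[OF \<tau> w]] by auto
      moreover have "cnj \<tau> * (2 * \<tau> / (w + 1))\<^sup>2 = (\<tau> * cnj \<tau>) * (4 * \<tau> / (w + 1)\<^sup>2)"
        by (simp add: power2_eq_square)
      ultimately show ?thesis
        unfolding \<phi>w bp_factor[OF \<tau>] unfolding diff_icay[OF w] P_def by (simp add: cnj_unit[OF \<tau>])
    qed
    ultimately show ?thesis by (simp add: o_def \<phi>_def)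
  qed
  show thesis
  proof
    show "is_generator_of ?G \<phi>"
      unfolding is_generator_of_def
    proof (intro conjI ballI allI impI)
      show "?G holomorphic_on unit_disc"
        by (intro holomorphic_intros hol) (use Rep in force)
    qed (use der has_vector_derivative_at_within in blast)
    show "is_semigroup \<phi>"
      unfolding is_semigroup_def
    proof (intro conjI ballI allI impI)
      fix t :: real assume t: "t \<ge> 0"
      have "\<Phi> t \<circ> cay \<tau> holomorphic_on unit_disc"
        by (rule holomorphic_on_compose_gen[OF holomorphic_cay[OF \<tau>] \<Phi>(1)[OF t]]) (use cay_in in blast)
      then have "icay \<tau> \<circ> (\<Phi> t \<circ> cay \<tau>) holomorphic_on unit_disc"
        by (rule holomorphic_on_compose_gen[OF _ holomorphic_icay]) (use \<Phi>_in[OF t] in auto)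
      then show "\<phi> t holomorphic_on unit_disc" by (simp add: \<phi>_def o_def)
      show "\<phi> t ` unit_disc \<subseteq> unit_disc" using in_disc[OF t] by blast
    next
      fix s t z assume "0 \<le> (s::real)" "0 \<le> (t::real)" "z \<in> unit_disc"
      then show "\<phi> s (\<phi> t z) = \<phi> (s + t) z"
        using cay\<phi>[of t z] \<Phi>(4)[of s t "cay \<tau> z"] cay_in[of z] by (simp add: \<phi>_def)
    next
      fix z assume z: "z \<in> unit_disc"
      have "isCont (\<lambda>s. \<phi> s z) 0"
        using has_vector_derivative_continuous[OF der[OF order_refl z]] by simp
      then show "((\<lambda>t. \<phi> t z) \<longlongrightarrow> z) (at_right 0)"
        using \<phi>0[OF z] by (simp add: isCont_def filterlim_at_split)
    qed (rule \<phi>0)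
    show "boundary_DW_point \<phi> \<tau>"
      unfolding boundary_DW_point_def
    proof
      fix z assume z: "z \<in> unit_disc"
      have lim: "filterlim (\<lambda>t. \<Phi> t (cay \<tau> z)) at_infinity at_top" by (rule \<Phi>(6)[OF cay_in[OF z]])
      have "((\<lambda>w. 2 * \<tau> / (w + 1)) \<longlongrightarrow> 0) at_infinity"
        by (intro tendsto_divide_0[OF tendsto_const] tendsto_add_filterlim_at_infinity'[OF filterlim_ident tendsto_const])
      from filterlim_compose[OF this lim]
      have "((\<lambda>t. \<tau> - 2 * \<tau> / (\<Phi> t (cay \<tau> z) + 1)) \<longlongrightarrow> \<tau> - 0) at_top"
        by (intro tendsto_intros)
      moreover have "\<forall>\<^sub>F t in at_top. \<tau> - 2 * \<tau> / (\<Phi> t (cay \<tau> z) + 1) = \<phi> t z"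
        using eventually_ge_at_top[of 0]
      proof eventually_elim
        case (elim t)
        show ?case unfolding \<phi>_def diff_icay[OF \<Phi>_in[OF elim z], symmetric] by simp
      qed
      ultimately show "((\<lambda>t. \<phi> t z) \<longlongrightarrow> \<tau>) at_top"
        using Lim_transform_eventually by fastforce
    qed
  qed
qed

section \<open>Boundary regular fixed points of the flow\<close>

text \<open>|g|^2 * exp (-2 * e * s) does not increase. The square keeps the argument smooth at
  zeros of g, and the open interval allows for the merely one-sided derivative of a semigroup at
  time 0.\<close>

lemma gronwall_cmod:
  fixes g k :: "real \<Rightarrow> complex"
  assumes T: "T \<ge> 0" and cont: "continuous_on {0..T} g"
    and der: "\<And>s. 0 < s \<Longrightarrow> s < T \<Longrightarrow> (g has_vector_derivative k s * g s) (at s)"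
    and k: "\<And>s. 0 < s \<Longrightarrow> s < T \<Longrightarrow> cmod (k s) \<le> e"
  shows "cmod (g T) \<le> cmod (g 0) * exp (e * T)"
proof -
  define N where "N = (\<lambda>s. ((Re (g s))\<^sup>2 + (Im (g s))\<^sup>2) * exp (- 2 * e * s))"
  have "N T \<le> N 0"
  proof (rule DERIV_nonpos_imp_decreasing_open[OF T])
    show "continuous_on {0..T} N" unfolding N_def by (intro continuous_intros cont)
    fix s assume s: "0 < s" "s < T"
    have dR: "((\<lambda>s. Re (g s)) has_real_derivative Re (k s * g s)) (at s)"
      and dI: "((\<lambda>s. Im (g s)) has_real_derivative Im (k s * g s)) (at s)"
      using bounded_linear.has_vector_derivative[OF bounded_linear_Re der[OF s]]
        bounded_linear.has_vector_derivative[OF bounded_linear_Im der[OF s]]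
      by (simp_all add: has_real_derivative_iff_has_vector_derivative)
    have dE: "((\<lambda>s. exp (- 2 * e * s)) has_real_derivative exp (- 2 * e * s) * (- 2 * e)) (at s)"
      by (auto intro!: derivative_eq_intros)
    have "(N has_real_derivative
        (2 * Re (g s) * Re (k s * g s) + 2 * Im (g s) * Im (k s * g s)) * exp (- 2 * e * s)
        + exp (- 2 * e * s) * (- 2 * e) * ((Re (g s))\<^sup>2 + (Im (g s))\<^sup>2)) (at s)"
      unfolding N_def
      using DERIV_mult[OF DERIV_add[OF DERIV_power[OF dR, of 2] DERIV_power[OF dI, of 2]] dE]
      by (simp add: mult_ac)
    moreover have "(2 * Re (g s) * Re (k s * g s) + 2 * Im (g s) * Im (k s * g s)) * exp (- 2 * e * s)
        + exp (- 2 * e * s) * (- 2 * e) * ((Re (g s))\<^sup>2 + (Im (g s))\<^sup>2)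
        = 2 * (Re (k s) - e) * (((Re (g s))\<^sup>2 + (Im (g s))\<^sup>2) * exp (- 2 * e * s))"
      by (simp add: algebra_simps power2_eq_square)
    moreover have "2 * (Re (k s) - e) * (((Re (g s))\<^sup>2 + (Im (g s))\<^sup>2) * exp (- 2 * e * s)) \<le> 0"
      using order_trans[OF complex_Re_le_cmod k[OF s]]
      by (intro mult_nonpos_nonneg[of "2 * (Re (k s) - e)"]) auto
    ultimately show "\<exists>y. (N has_real_derivative y) (at s) \<and> y \<le> 0" by metis
  qed
  then have "(cmod (g T))\<^sup>2 * exp (- 2 * e * T) \<le> (cmod (g 0))\<^sup>2"
    by (simp add: N_def cmod_power2)
  then have "(cmod (g T))\<^sup>2 * exp (- 2 * e * T) * exp (2 * e * T) \<le> (cmod (g 0))\<^sup>2 * exp (2 * e * T)"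
    by (intro mult_right_mono) auto
  then have "(cmod (g T))\<^sup>2 \<le> (cmod (g 0) * exp (e * T))\<^sup>2"
    by (simp add: mult.assoc power_mult_distrib flip: exp_add exp_double)
  then show ?thesis by (rule power2_le_imp_le) simp
qed

text \<open>The distance vector D = \<sigma> - \<phi> satisfies D' = -K * D with K close to l as
  long as D is small. One Gronwall estimate keeps D small up to time t, a second one compares D with
  exp (-l * s). The limit is taken within the whole disc, so no orbit has to be held in a Stolz
  region.\<close>

lemma linearization_BRFP:
  assumes \<phi>: "is_semigroup \<phi>" and G: "is_generator_of G \<phi>" and \<sigma>: "cmod \<sigma> = 1"
    and lim: "((\<lambda>z. G z / (\<sigma> - z)) \<longlongrightarrow> of_real l) (at \<sigma> within unit_disc)"
  shows "BRFP_spectral \<phi> \<sigma> l"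
proof -
  have \<phi>_in: "\<phi> s z \<in> unit_disc" if "s \<ge> 0" "z \<in> unit_disc" for s z
    using \<phi> that unfolding is_semigroup_def by blast
  have \<phi>0: "\<phi> 0 z = z" if "z \<in> unit_disc" for z
    using \<phi> that by (auto simp: is_semigroup_def)
  let ?F = "at \<sigma> within unit_disc"
  have main: "((\<lambda>z. (\<phi> t z - \<sigma>) / (z - \<sigma>)) \<longlongrightarrow> of_real (exp (- l * t))) ?F" if t: "t > 0" for t
  proof -
    define B where "B = (\<lambda>e::real. t * e * exp (e * t))"
    have close: "\<forall>\<^sub>F z in ?F. cmod ((\<phi> t z - \<sigma>) / (z - \<sigma>) * exp (l * t) - 1) \<le> B e" if e: "e > 0" for e
    proof -
      obtain r where r: "r > 0" and Gr0: "\<forall>z\<in>unit_disc. z \<noteq> \<sigma> \<and> dist z \<sigma> < r \<longrightarrow> dist (G z / (\<sigma> - z)) (of_real l) < e"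
        using tendstoD[OF lim e] unfolding eventually_at by blast
      have Gr: "cmod (G z / (\<sigma> - z) - of_real l) < e" if "z \<in> unit_disc" "cmod (\<sigma> - z) < r" for z
        using bspec[OF Gr0 that(1)] that(2) unit_disc_ne[OF \<sigma> that(1)]
        by (auto simp: dist_norm norm_minus_commute)
      define M where "M = \<bar>l\<bar> + e"
      have M: "M > 0" using e by (simp add: M_def)
      have "cmod ((\<phi> t z - \<sigma>) / (z - \<sigma>) * exp (l * t) - 1) \<le> B e"
        \<comment> \<open>Near \<sigma> the rate K is at most M in modulus, so |D| grows at most by
          exp (M * t) and stays below r until t.\<close>
        if z: "z \<in> unit_disc" and small: "cmod (\<sigma> - z) < r / exp (M * t)" for z
      proof -
        define D where "D = (\<lambda>s. \<sigma> - \<phi> s z)"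
        define K where "K = (\<lambda>s. G (\<phi> s z) / D s)"
        have D0: "D 0 = \<sigma> - z" using \<phi>0[OF z] by (simp add: D_def)
        have D_ne: "D s \<noteq> 0" if "s \<ge> 0" for s
          unfolding D_def by (rule unit_disc_ne[OF \<sigma> \<phi>_in[OF that z]])
        have der0: "((\<lambda>s. \<phi> s z) has_vector_derivative G (\<phi> s z)) (at s within {0..})" if "s \<ge> 0" for s
          using G z that by (simp add: is_generator_of_def)
        have contD: "continuous_on {0..} D"
          unfolding D_def continuous_on_eq_continuous_within
          using has_vector_derivative_continuous[OF der0] by (auto intro!: continuous_intros)
        have derD: "(D has_vector_derivative - K s * D s) (at s)" if s: "s > 0" for s
        proof -
          have "at s within {0..} = at s" using s by (intro at_within_interior) simp
          then have "((\<lambda>s. \<phi> s z) has_vector_derivative G (\<phi> s z)) (at s)"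
            using der0[of s] s by simp
          then have "(D has_vector_derivative - G (\<phi> s z)) (at s)"
            unfolding D_def by (auto intro!: derivative_eq_intros)
          then show ?thesis using D_ne[of s] s by (simp add: K_def)
        qed
        have K: "cmod (K s - of_real l) < e" if "s \<ge> 0" "cmod (D s) < r" for s
          using Gr[OF \<phi>_in[OF that(1) z]] that(2) by (simp add: K_def D_def)
        have KM: "cmod (- K s) \<le> M" if "s \<ge> 0" "cmod (D s) < r" for s
        proof -
          have "cmod (K s) \<le> cmod (K s - of_real l) + cmod (complex_of_real l)"
            by (metis diff_add_cancel norm_triangle_ineq)
          then show ?thesis using K[OF that] by (simp add: M_def)
        qed
        have D0r: "cmod (D 0) * exp (M * s) < r" if "s \<le> t" for s
        proof -
          have "cmod (D 0) * exp (M * s) \<le> cmod (D 0) * exp (M * t)"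
            using that M by (intro mult_left_mono) auto
          then show ?thesis using small by (simp add: D0 pos_less_divide_eq)
        qed
        have Dr: "cmod (D s) < r" if s: "0 \<le> s" "s \<le> t" for s
        proof (rule ccontr)
          assume nr: "\<not> ?thesis"
          \<comment> \<open>Its infimum u is the first time at which |D| reaches r. Before u the
            bound on K holds, so Gronwall on [0, u] keeps |D u| below r after all.\<close>
          define E where "E = {s \<in> {0..t}. cmod (D s) \<in> {r..}}"
          have "closed E"
            unfolding E_def
            by (intro continuous_closed_preimage[unfolded vimage_def Int_def mem_Collect_eq] continuous_intros)
              (auto intro: continuous_on_subset[OF contD])
          moreover have "E \<noteq> {}" using nr s by (auto simp: E_def)
          moreover have bdd: "bdd_below E" by (rule bdd_belowI[of _ 0]) (simp add: E_def)
          ultimately have E: "Inf E \<in> E" by (intro closed_contains_Inf)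
          define u where "u = Inf E"
          have u: "0 \<le> u" "u \<le> t" "cmod (D u) \<ge> r" using E by (auto simp: E_def u_def)
          have before: "cmod (D s) < r" if "0 \<le> s" "s < u" for s
          proof (rule ccontr)
            assume "\<not> ?thesis"
            then have "s \<in> E" using that u by (simp add: E_def)
            then have "u \<le> s" unfolding u_def by (rule cInf_lower[OF _ bdd])
            then show False using that by simp
          qed
          have "cmod (D u) \<le> cmod (D 0) * exp (M * u)"
          proof (rule gronwall_cmod[OF u(1), where k = "\<lambda>s. - K s"])
            show "continuous_on {0..u} D" by (rule continuous_on_subset[OF contD]) auto
          qed (use derD KM before in auto)
          then show False using D0r[OF u(2)] u(3) by simp
        qed
        \<comment> \<open>Multiplying by exp (l * s) removes the expected decay or growth; what
          remains changes at a relative rate of at most e. The mean value theorem then yields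
          \<open>B e\<close>.\<close>
        define g where "g = (\<lambda>s. D s * of_real (exp (l * s)))"
        have contg: "continuous_on {0..s} g" for s
          unfolding g_def by (intro continuous_intros continuous_on_subset[OF contD]) auto
        have derg: "(g has_vector_derivative (of_real l - K s) * g s) (at s)" if "s > 0" for s
        proof -
          have "((\<lambda>s. complex_of_real (exp (l * s))) has_vector_derivative of_real (exp (l * s) * l)) (at s)"
            by (intro has_vector_derivative_of_real) (auto intro!: derivative_eq_intros)
          from has_vector_derivative_mult[OF derD[OF that] this] show ?thesis
            by (simp add: g_def algebra_simps)
        qed
        have ke: "cmod (of_real l - K s) \<le> e" if "0 \<le> s" "s \<le> t" for s
          using K[OF that(1) Dr[OF that]] by (simp add: norm_minus_commute)
        have gb: "cmod (g s) \<le> cmod (g 0) * exp (e * s)" if "0 \<le> s" "s \<le> t" for s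
          by (rule gronwall_cmod[OF that(1) contg, where k = "\<lambda>s. of_real l - K s"]) (use derg ke that in auto)
        obtain x where x: "x \<in> {0<..<t}" and "cmod (g t - g 0) \<le> cmod ((t - 0) *\<^sub>R ((of_real l - K x) * g x))"
          using mvt_general[OF t contg, of "\<lambda>x h. h *\<^sub>R ((of_real l - K x) * g x)"] derg
          by (auto simp: has_vector_derivative_def)
        then have "cmod (g t - g 0) \<le> t * (cmod (of_real l - K x) * cmod (g x))"
          using t by (simp add: norm_mult)
        also have "\<dots> \<le> t * (e * (cmod (g 0) * exp (e * t)))"
        proof -
          have "cmod (g x) \<le> cmod (g 0) * exp (e * x)" using x by (intro gb) auto
          also have "\<dots> \<le> cmod (g 0) * exp (e * t)"
            using x e by (intro mult_left_mono) auto
          finally show ?thesis using x t e by (intro mult_left_mono mult_mono ke) auto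
        qed
        finally have "cmod (g t - g 0) \<le> B e * cmod (g 0)" by (simp add: B_def mult_ac)
        moreover have g0: "g 0 = \<sigma> - z" "g 0 \<noteq> 0" using D0 D_ne[of 0] by (simp_all add: g_def)
        moreover have "(\<phi> t z - \<sigma>) / (z - \<sigma>) * exp (l * t) - 1 = (g t - g 0) / g 0"
          using g0 by (simp add: g_def D_def divide_simps) (simp add: algebra_simps)
        ultimately show ?thesis
          by (simp only: norm_divide) (simp add: pos_divide_le_eq)
      qed
      moreover have "\<forall>\<^sub>F z in ?F. z \<in> unit_disc \<and> cmod (\<sigma> - z) < r / exp (M * t)"
        unfolding eventually_at using r
        by (intro exI[of _ "r / exp (M * t)"]) (auto simp: dist_norm norm_minus_commute)
      ultimately show ?thesis by (auto elim!: eventually_mono)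
    qed
    have "((\<lambda>z. (\<phi> t z - \<sigma>) / (z - \<sigma>) * exp (l * t)) \<longlongrightarrow> 1) ?F"
    proof (rule tendstoI)
      fix y :: real assume "y > 0"
      have "(B \<longlongrightarrow> t * 0 * exp (0 * t)) (at_right 0)"
        unfolding B_def by (intro tendsto_intros)
      then have "(B \<longlongrightarrow> 0) (at_right 0)" by simp
      from order_tendstoD(2)[OF this \<open>y > 0\<close>] obtain e where "e > 0" "B e < y"
        using eventually_happens'[OF trivial_limit_at_right_real[of 0], of "\<lambda>e. B e < y \<and> e > 0"]
        by (auto simp: eventually_conj_iff eventually_at_right_less)
      then show "\<forall>\<^sub>F z in ?F. dist ((\<phi> t z - \<sigma>) / (z - \<sigma>) * exp (l * t)) 1 < y"
        using close[of e] by (auto elim!: eventually_mono simp: dist_norm)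
    qed
    then have "((\<lambda>z. (\<phi> t z - \<sigma>) / (z - \<sigma>) * exp (l * t) * of_real (exp (- l * t))) \<longlongrightarrow> 1 * of_real (exp (- l * t))) ?F"
      by (intro tendsto_intros)
    then show ?thesis
      by (simp add: mult.assoc flip: of_real_mult exp_of_real exp_add)
  qed
  have quot: "((\<lambda>z. (\<phi> t z - \<sigma>) / (z - \<sigma>)) \<longlongrightarrow> of_real (exp (- l * t))) ?F" if t: "t \<ge> 0" for t
  proof (cases "t = 0")
    case True
    have "\<forall>\<^sub>F z in ?F. 1 = (\<phi> t z - \<sigma>) / (z - \<sigma>)"
      using \<phi>0 by (auto simp: True eventually_at_filter)
    from Lim_transform_eventually[OF tendsto_const this] show ?thesis by (simp add: True)
  qed (use main t in simp)
  have "(\<phi> t \<longlongrightarrow> \<sigma>) ?F" if t: "t \<ge> 0" for t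
  proof -
    have "((\<lambda>z. \<sigma> + (\<phi> t z - \<sigma>) / (z - \<sigma>) * (z - \<sigma>)) \<longlongrightarrow> \<sigma> + of_real (exp (- l * t)) * (\<sigma> - \<sigma>)) ?F"
      by (intro tendsto_intros quot[OF t])
    then have "((\<lambda>z. \<sigma> + (\<phi> t z - \<sigma>) / (z - \<sigma>) * (z - \<sigma>)) \<longlongrightarrow> \<sigma>) ?F" by simp
    then show ?thesis
      by (rule Lim_transform_eventually) (auto simp: eventually_at_filter)
  qed
  then show ?thesis
    unfolding BRFP_spectral_def using quot tendsto_angular_limit by blast
qed

text \<open>A pole of p at \<sigma> is a simple zero of G, whose slope is real by
  \<open>diff_sq_eq\<close>. For a = \<open>\<alpha> k\<close> the spectral value is
  \<open>\<Lambda> k\<close>.\<close>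

lemma BRFP_generated:
  assumes \<phi>: "is_semigroup \<phi>" and G: "is_generator_of (\<lambda>z. (\<tau> - z) * (1 - cnj \<tau> * z) / p z) \<phi>"
    and \<tau>: "cmod \<tau> = 1" and \<sigma>: "cmod \<sigma> = 1" and a: "a > 0"
    and lim: "((\<lambda>z. (\<sigma> - z) * p z) \<longlongrightarrow> 2 * \<sigma> * of_real a) (at \<sigma> within unit_disc)"
  shows "BRFP_spectral \<phi> \<sigma> (- ((cmod (\<tau> - \<sigma>))\<^sup>2 / (2 * a)))"
proof (rule linearization_BRFP[OF \<phi> G \<sigma>])
  have \<sigma>0: "\<sigma> \<noteq> 0" using \<sigma> by auto
  have "((\<lambda>z. cnj \<tau> * (\<tau> - z)\<^sup>2 / ((\<sigma> - z) * p z)) \<longlongrightarrow> cnj \<tau> * (\<tau> - \<sigma>)\<^sup>2 / (2 * \<sigma> * of_real a)) (at \<sigma> within unit_disc)"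
    by (intro tendsto_intros lim) (use \<sigma>0 a in auto)
  moreover have "cnj \<tau> * (\<tau> - \<sigma>)\<^sup>2 / (2 * \<sigma> * of_real a) = of_real (- ((cmod (\<tau> - \<sigma>))\<^sup>2 / (2 * a)))"
    unfolding diff_sq_eq[OF \<tau> \<sigma>] using \<sigma>0 by simp
  moreover have "(\<tau> - z) * (1 - cnj \<tau> * z) / p z / (\<sigma> - z) = cnj \<tau> * (\<tau> - z)\<^sup>2 / ((\<sigma> - z) * p z)" for z
    unfolding bp_factor[OF \<tau>] by (simp add: mult.commute)
  ultimately show "((\<lambda>z. (\<tau> - z) * (1 - cnj \<tau> * z) / p z / (\<sigma> - z)) \<longlongrightarrow> of_real (- ((cmod (\<tau> - \<sigma>))\<^sup>2 / (2 * a)))) (at \<sigma> within unit_disc)"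
    by (simp only:)
qed

lemma p0_eq: "p0 n \<sigma> \<alpha> z = (\<Sum>k<n. of_real (\<alpha> k) * cay (\<sigma> k) z)"
  by (simp add: p0_def cay_def)

section \<open>The value region\<close>

locale brfp_data =
  fixes n :: nat and \<sigma> :: "nat \<Rightarrow> complex" and \<Lambda> :: "nat \<Rightarrow> real" and \<tau> :: complex
    and \<alpha> :: "nat \<Rightarrow> real"
  assumes n_pos: "n \<ge> 1"
    and \<sigma>_bd: "\<And>k. k < n \<Longrightarrow> cmod (\<sigma> k) = 1"
    and \<sigma>_inj: "inj_on \<sigma> {..<n}"
    and \<Lambda>_neg: "\<And>k. k < n \<Longrightarrow> \<Lambda> k < 0"
    and \<tau>_bd: "cmod \<tau> = 1"
    and \<tau>_notin: "\<tau> \<notin> \<sigma> ` {..<n}"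
    and \<alpha>_def: "\<And>k. \<alpha> k = (cmod (\<tau> - \<sigma> k))\<^sup>2 / (2 * \<bar>\<Lambda> k\<bar>)"
begin

abbreviation A :: real where "A \<equiv> (\<Sum>k<n. \<alpha> k)"

lemma \<alpha>_pos:
  assumes "k < n" shows "\<alpha> k > 0"
proof -
  have "\<tau> - \<sigma> k \<noteq> 0" "\<bar>\<Lambda> k\<bar> > 0" using assms \<Lambda>_neg[of k] \<tau>_notin by auto
  then show ?thesis unfolding \<alpha>_def by (intro divide_pos_pos) auto
qed

lemma A_pos: "A > 0"
  using n_pos \<alpha>_pos by (intro sum_pos) (auto simp: lessThan_empty_iff)

lemma p0_0: "p0 n \<sigma> \<alpha> 0 = of_real A"
  by (simp add: p0_eq \<sigma>_bd)

lemma holomorphic_p0: "p0 n \<sigma> \<alpha> holomorphic_on unit_disc"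
  unfolding p0_eq by (intro holomorphic_intros holomorphic_cay \<sigma>_bd) auto

lemma Re_p0_pos: "z \<in> unit_disc \<Longrightarrow> Re (p0 n \<sigma> \<alpha> z) > 0"
  unfolding p0_eq Re_sum using n_pos \<alpha>_pos Re_cay_pos[OF \<sigma>_bd]
  by (intro sum_pos) (auto simp: lessThan_empty_iff)

text \<open>Prescribed atoms: a at \<tau> and exactly \<open>\<alpha> k\<close> at
  \<open>\<sigma> k\<close>, plus a constant l. These functions already realize every point of the
  value region.\<close>

definition pdata :: "real \<Rightarrow> complex \<Rightarrow> complex \<Rightarrow> complex" where
  "pdata a l z = of_real a * cay \<tau> z + l + p0 n \<sigma> \<alpha> z"

lemma holomorphic_pdata: "pdata a l holomorphic_on unit_disc"
  unfolding pdata_def by (intro holomorphic_intros holomorphic_cay \<tau>_bd holomorphic_p0)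

lemma Re_pdata_pos:
  assumes "a \<ge> 0" "Re l \<ge> 0" "z \<in> unit_disc"
  shows "Re (pdata a l z) > 0"
  using Re_p0_pos[OF assms(3)] Re_cay_pos[OF \<tau>_bd assms(3)] assms
  by (auto simp: pdata_def intro!: add_nonneg_pos)

lemma pdata_0: "pdata a l 0 = of_real (a + A) + l"
  by (simp add: pdata_def p0_0 \<tau>_bd)

lemma tendsto_pdata_\<sigma>:
  assumes k: "k < n"
  shows "((\<lambda>z. (\<sigma> k - z) * pdata a l z) \<longlongrightarrow> 2 * \<sigma> k * of_real (\<alpha> k)) (at (\<sigma> k) within unit_disc)"
proof -
  let ?R = "\<lambda>z. of_real a * cay \<tau> z + l + (\<Sum>j\<in>{..<n} - {k}. of_real (\<alpha> j) * cay (\<sigma> j) z)"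
  have ne: "\<sigma> k \<noteq> \<tau>" "\<And>j. j \<in> {..<n} - {k} \<Longrightarrow> \<sigma> j \<noteq> \<sigma> k"
    using k \<tau>_notin inj_onD[OF \<sigma>_inj] by blast+
  have "((\<lambda>z. of_real (\<alpha> k) * (\<sigma> k + z) + (\<sigma> k - z) * ?R z) \<longlongrightarrow>
      of_real (\<alpha> k) * (\<sigma> k + \<sigma> k) + (\<sigma> k - \<sigma> k) * ?R (\<sigma> k)) (at (\<sigma> k) within unit_disc)"
    unfolding cay_def by (intro tendsto_intros) (use ne in auto)
  then have "((\<lambda>z. of_real (\<alpha> k) * (\<sigma> k + z) + (\<sigma> k - z) * ?R z) \<longlongrightarrow>
      2 * \<sigma> k * of_real (\<alpha> k)) (at (\<sigma> k) within unit_disc)" by (simp add: mult.commute)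
  moreover have "\<forall>\<^sub>F z in at (\<sigma> k) within unit_disc.
      of_real (\<alpha> k) * (\<sigma> k + z) + (\<sigma> k - z) * ?R z = (\<sigma> k - z) * pdata a l z"
    unfolding eventually_at_filter
  proof (intro always_eventually allI impI)
    fix z assume "z \<noteq> \<sigma> k"
    have "pdata a l z = ?R z + of_real (\<alpha> k) * cay (\<sigma> k) z"
      using k by (simp add: pdata_def p0_eq sum.remove[of "{..<n}" k])
    then show "of_real (\<alpha> k) * (\<sigma> k + z) + (\<sigma> k - z) * ?R z = (\<sigma> k - z) * pdata a l z"
      unfolding mult_cay[OF \<open>z \<noteq> \<sigma> k\<close>, symmetric] by (simp add: algebra_simps)
  qed
  ultimately show ?thesis by (rule Lim_transform_eventually)
qed

lemma tendsto_pdata_\<tau>: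
  "((\<lambda>z. (\<tau> - z) * pdata a l z) \<longlongrightarrow> 2 * \<tau> * of_real a) (at \<tau> within unit_disc)"
proof -
  let ?R = "\<lambda>z. l + (\<Sum>j<n. of_real (\<alpha> j) * cay (\<sigma> j) z)"
  have "((\<lambda>z. of_real a * (\<tau> + z) + (\<tau> - z) * ?R z) \<longlongrightarrow>
      of_real a * (\<tau> + \<tau>) + (\<tau> - \<tau>) * ?R \<tau>) (at \<tau> within unit_disc)"
    unfolding cay_def by (intro tendsto_intros) (use \<tau>_notin in auto)
  then have "((\<lambda>z. of_real a * (\<tau> + z) + (\<tau> - z) * ?R z) \<longlongrightarrow>
      2 * \<tau> * of_real a) (at \<tau> within unit_disc)" by (simp add: mult.commute)
  moreover have "\<forall>\<^sub>F z in at \<tau> within unit_disc.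
      of_real a * (\<tau> + z) + (\<tau> - z) * ?R z = (\<tau> - z) * pdata a l z"
    unfolding eventually_at_filter
  proof (intro always_eventually allI impI)
    fix z assume "z \<noteq> \<tau>"
    then show "of_real a * (\<tau> + z) + (\<tau> - z) * ?R z = (\<tau> - z) * pdata a l z"
      unfolding mult_cay[OF \<open>z \<noteq> \<tau>\<close>, symmetric] by (simp add: pdata_def p0_eq algebra_simps)
  qed
  ultimately show ?thesis by (rule Lim_transform_eventually)
qed

definition Gdata :: "real \<Rightarrow> complex \<Rightarrow> complex \<Rightarrow> complex" where
  "Gdata a l z = (\<tau> - z) * (1 - cnj \<tau> * z) / pdata a l z"

lemma Gdata_0: "Gdata a l 0 = \<tau> / (of_real (a + A) + l)"
  by (simp add: Gdata_def pdata_0)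

context
  fixes a :: real and l :: complex
  assumes al: "a \<ge> 0" "Re l \<ge> 0"
begin

lemma Gdata_ne_0:
  assumes "z \<in> unit_disc" shows "Gdata a l z \<noteq> 0"
proof -
  have "pdata a l z \<noteq> 0" using Re_pdata_pos[OF al assms] by auto
  then show ?thesis
    unfolding Gdata_def bp_factor[OF \<tau>_bd] using unit_disc_ne[OF \<tau>_bd assms] \<tau>_bd by auto
qed

lemma bp_Gdata: "z \<in> unit_disc \<Longrightarrow> bp \<tau> (Gdata a l) z = pdata a l z"
  using Gdata_ne_0[of z] by (simp add: bp_def Gdata_def)

text \<open>The atoms are exactly \<open>\<alpha> k\<close>, so each spectral value is
  \<open>\<Lambda> k\<close>, the lower end of the allowed interval.\<close>

lemma Gdata_in_Gen_FL: "Gdata a l \<in> Gen_FL \<tau> n \<sigma> \<Lambda>"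
proof -
  obtain \<phi> where \<phi>: "is_semigroup \<phi>" "is_generator_of (\<lambda>z. (\<tau> - z) * (1 - cnj \<tau> * z) / pdata a l z) \<phi>"
    "boundary_DW_point \<phi> \<tau>"
    by (rule generation[OF holomorphic_pdata Re_pdata_pos[OF al] \<tau>_bd])
  have "BRFP_spectral \<phi> (\<sigma> k) (\<Lambda> k)" if k: "k < n" for k
  proof -
    have "BRFP_spectral \<phi> (\<sigma> k) (- ((cmod (\<tau> - \<sigma> k))\<^sup>2 / (2 * \<alpha> k)))"
      by (rule BRFP_generated[OF \<phi>(1,2) \<tau>_bd \<sigma>_bd[OF k] \<alpha>_pos[OF k] tendsto_pdata_\<sigma>[OF k]])
    moreover have "\<tau> - \<sigma> k \<noteq> 0" using k \<tau>_notin by auto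
    then have "- ((cmod (\<tau> - \<sigma> k))\<^sup>2 / (2 * \<alpha> k)) = \<Lambda> k"
      using \<Lambda>_neg[OF k] by (simp add: \<alpha>_def)
    ultimately show ?thesis by simp
  qed
  moreover have "(\<lambda>z. (\<tau> - z) * (1 - cnj \<tau> * z) / pdata a l z) = Gdata a l"
    by (simp add: Gdata_def fun_eq_iff)
  ultimately show ?thesis
    using \<phi> \<Lambda>_neg unfolding Gen_FL_def by (auto intro!: exI[of _ \<phi>] less_imp_le)
qed

lemma beta_Gdata: "beta \<tau> (Gdata a l) = of_real (2 * a)"
proof -
  have hol: "bp \<tau> (Gdata a l) holomorphic_on unit_disc"
    using holomorphic_pdata by (rule holomorphic_transform) (simp add: bp_Gdata)
  have Re: "Re (bp \<tau> (Gdata a l) z) \<ge> 0" if "z \<in> unit_disc" for z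
    using Re_pdata_pos[OF al that] by (simp add: bp_Gdata[OF that])
  have "mass (bp \<tau> (Gdata a l)) \<tau> = a"
  proof (rule mass_eqI[OF hol Re \<tau>_bd])
    show "angular_limit (\<lambda>z. (\<tau> - z) * bp \<tau> (Gdata a l) z) \<tau> (2 * \<tau> * of_real a)"
      using tendsto_angular_limit[OF tendsto_pdata_\<tau>[of a l]]
      by (subst angular_limit_cong[of _ "\<lambda>z. (\<tau> - z) * pdata a l z"]) (simp_all add: bp_Gdata)
  qed
  then show ?thesis
    using angular_limit_beta[OF \<tau>_bd Gdata_ne_0 hol Re] by simp
qed

end

lemma Gen_FL_extract:
  assumes G: "G \<in> Gen_FL \<tau> n \<sigma> \<Lambda>" and nz: "\<not> (\<forall>z\<in>unit_disc. G z = 0)"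
  obtains m where "m \<ge> 0" "beta \<tau> G = of_real (2 * m)" "G 0 \<noteq> 0"
    "m \<le> Re (\<tau> / G 0 - of_real A)"
    "m = Re (\<tau> / G 0 - of_real A) \<Longrightarrow>
      \<forall>z\<in>unit_disc. G z = Gdata m (\<i> * of_real (Im (\<tau> / G 0 - of_real A))) z"
proof -
  obtain \<phi> where \<phi>: "is_semigroup \<phi>" "is_generator_of G \<phi>" "boundary_DW_point \<phi> \<tau>"
    and br: "\<forall>k<n. \<exists>\<mu>. \<Lambda> k \<le> \<mu> \<and> \<mu> \<le> 0 \<and> BRFP_spectral \<phi> (\<sigma> k) \<mu>"
    using G nz by (auto simp: Gen_FL_def)
  note p = berkson_porta[OF \<phi> \<tau>_bd nz]
  define p where "p = bp \<tau> G"
  define m where "m = mass p \<tau>"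
  have mass_ge: "\<alpha> k \<le> mass p (\<sigma> k)" if k: "k < n" for k
  proof -
    obtain \<mu> where "\<Lambda> k \<le> \<mu>" "BRFP_spectral \<phi> (\<sigma> k) \<mu>" using br k by blast
    then show ?thesis
      unfolding \<alpha>_def p_def using k \<tau>_notin
      by (intro mass_bp_ge[OF \<phi> \<tau>_bd nz \<sigma>_bd[OF k]] \<Lambda>_neg) auto
  qed
  \<comment> \<open>At \<open>\<sigma> k\<close> only \<open>\<alpha> k\<close> is removed, not the
    full mass: a spectral value may lie above \<open>\<Lambda> k\<close>, and the excess mass stays
    in q.\<close>
  define q where "q = (\<lambda>z. p z - (p0 n \<sigma> \<alpha> z + of_real m * cay \<tau> z))"
  have holq: "q holomorphic_on unit_disc"
    unfolding q_def p_def by (intro holomorphic_intros p(2) holomorphic_p0 holomorphic_cay \<tau>_bd)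
  have Req: "Re (q z) \<ge> 0" if z: "z \<in> unit_disc" for z
  proof -
    have "(\<Sum>s\<in>insert \<tau> (\<sigma> ` {..<n}). mass p s * Re (cay s z)) \<le> Re (p z)"
      unfolding p_def by (rule sum_mass_le_Re) (use p \<tau>_bd \<sigma>_bd z in auto)
    also have "(\<Sum>s\<in>insert \<tau> (\<sigma> ` {..<n}). mass p s * Re (cay s z))
        = m * Re (cay \<tau> z) + (\<Sum>k<n. mass p (\<sigma> k) * Re (cay (\<sigma> k) z))"
      using \<tau>_notin by (simp add: m_def sum.reindex[OF \<sigma>_inj])
    finally have "m * Re (cay \<tau> z) + (\<Sum>k<n. mass p (\<sigma> k) * Re (cay (\<sigma> k) z)) \<le> Re (p z)" .
    moreover have "(\<Sum>k<n. \<alpha> k * Re (cay (\<sigma> k) z)) \<le> (\<Sum>k<n. mass p (\<sigma> k) * Re (cay (\<sigma> k) z))"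
      by (intro sum_mono mult_right_mono) (use mass_ge Re_cay_pos[OF \<sigma>_bd z] in \<open>auto intro: less_imp_le\<close>)
    ultimately show ?thesis by (simp add: q_def p0_eq)
  qed
  have G0: "G 0 \<noteq> 0" by (rule p(1)) simp
  have q0: "q 0 = \<tau> / G 0 - of_real A - of_real m"
    by (simp add: q_def p0_0 p_def bp_def \<tau>_bd)
  show thesis
  proof
    show "m \<ge> 0" unfolding m_def p_def by (rule mass_nonneg[OF p(2,3) \<tau>_bd])
    show "beta \<tau> G = of_real (2 * m)"
      unfolding m_def p_def by (rule angular_limit_beta[OF \<tau>_bd p])
    show "G 0 \<noteq> 0" by (rule G0)
    show "m \<le> Re (\<tau> / G 0 - of_real A)"
      using Req[of 0] by (simp add: q0)
    assume m: "m = Re (\<tau> / G 0 - of_real A)"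
    show "\<forall>z\<in>unit_disc. G z = Gdata m (\<i> * of_real (Im (\<tau> / G 0 - of_real A))) z"
    proof
      fix z assume z: "z \<in> unit_disc"
      have "q z = q 0"
        by (rule pick_const[OF holq Req _ _ z]) (use m in \<open>simp_all add: q0\<close>)
      also have "q 0 = \<i> * of_real (Im (\<tau> / G 0 - of_real A))"
        using m by (simp add: q0 complex_eq_iff)
      finally have "p z = pdata m (\<i> * of_real (Im (\<tau> / G 0 - of_real A))) z"
        by (simp add: q_def pdata_def algebra_simps)
      moreover have "G z = (\<tau> - z) * (1 - cnj \<tau> * z) / p z"
        using p(1)[OF z] unit_disc_ne[OF \<tau>_bd z] \<tau>_bd unfolding p_def bp_def bp_factor[OF \<tau>_bd] by auto
      ultimately show "G z = Gdata m (\<i> * of_real (Im (\<tau> / G 0 - of_real A))) z"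
        by (simp add: Gdata_def)
    qed
  qed
qed

end

text \<open>For w = \<tau>/\<zeta> the left side says that w is at least as close to 2A as to 0,
  which is the half-plane Re w \<ge> A.\<close>

lemma disc_iff_Re_ge:
  assumes "cmod \<tau> = 1" "A > 0" "\<zeta> \<noteq> 0"
  shows "cmod ((2 * inverse \<tau> * complex_of_real A) * \<zeta> - 1) \<le> 1 \<longleftrightarrow> 0 \<le> Re (\<tau> / \<zeta> - of_real A)"
proof -
  define w where "w = \<tau> / \<zeta>"
  have \<tau>0: "\<tau> \<noteq> 0" using assms by auto
  then have w: "cmod w > 0" using assms by (simp add: w_def)
  have "(2 * inverse \<tau> * complex_of_real A) * \<zeta> - 1 = (of_real (2 * A) - w) / w"
    using \<tau>0 assms by (simp add: w_def field_simps)
  then have "cmod ((2 * inverse \<tau> * complex_of_real A) * \<zeta> - 1) \<le> 1 \<longleftrightarrow> cmod (of_real (2 * A) - w) \<le> cmod w"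
    using w by (simp only: norm_divide) (simp add: pos_divide_le_eq)
  also have "\<dots> \<longleftrightarrow> (cmod (of_real (2 * A) - w))\<^sup>2 \<le> (cmod w)\<^sup>2"
    by (simp add: power2_le_iff_abs_le)
  also have "\<dots> \<longleftrightarrow> 4 * A * A \<le> 4 * A * Re w"
    unfolding cmod_power2 by (simp add: power2_eq_square algebra_simps)
  also have "\<dots> \<longleftrightarrow> A \<le> Re w"
    using assms(2) by simp
  finally show ?thesis by (simp add: w_def)
qed

theorem theorem6p11:
  fixes n :: nat and \<sigma> :: "nat \<Rightarrow> complex" and \<Lambda> :: "nat \<Rightarrow> real" and \<tau> :: complex
    and \<alpha> :: "nat \<Rightarrow> real" and A :: real and Z :: "complex set" and ell :: "complex \<Rightarrow> complex"
  assumes n_pos: "n \<ge> 1"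
    and \<sigma>_bd: "\<forall>k<n. cmod (\<sigma> k) = 1"
    and \<sigma>_inj: "inj_on \<sigma> {..<n}"
    and \<Lambda>_neg: "\<forall>k<n. \<Lambda> k < 0"
    and \<tau>_bd: "cmod \<tau> = 1"
    and \<tau>_notin: "\<tau> \<notin> \<sigma> ` {..<n}"
    and \<alpha>_def: "\<And>k. \<alpha> k = (cmod (\<tau> - \<sigma> k))\<^sup>2 / (2 * \<bar>\<Lambda> k\<bar>)"
    and A_def: "A = (\<Sum>k<n. \<alpha> k)"
    and Z_def: "Z = {\<zeta>. cmod ((2 * inverse \<tau> * complex_of_real A) * \<zeta> - 1) \<le> 1}"
    and ell_def: "\<And>\<zeta>. ell \<zeta> = \<tau> / \<zeta> - complex_of_real A"
  shows "{(G 0, beta \<tau> G) | G. G \<in> Gen_FL \<tau> n \<sigma> \<Lambda> \<and> \<not> (\<forall>z\<in>unit_disc. G z = 0)}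
           = {(\<zeta>, complex_of_real b) | \<zeta> b. \<zeta> \<in> Z - {0} \<and> 0 \<le> b \<and> b \<le> 2 * Re (ell \<zeta>)}
     \<and> (\<forall>\<zeta>\<in>Z - {0}.
          let G\<^sub>\<zeta> = (\<lambda>z. (\<tau> - z) * (1 - cnj \<tau> * z) /
                     ((\<tau> + z) / (\<tau> - z) * complex_of_real (Re (ell \<zeta>))
                      + \<i> * complex_of_real (Im (ell \<zeta>)) + p0 n \<sigma> \<alpha> z))
          in G\<^sub>\<zeta> \<in> Gen_FL \<tau> n \<sigma> \<Lambda> \<and> G\<^sub>\<zeta> 0 = \<zeta> \<and>
             beta \<tau> G\<^sub>\<zeta> = complex_of_real (2 * Re (ell \<zeta>)) \<and>
             (\<forall>G\<in>Gen_FL \<tau> n \<sigma> \<Lambda>. G 0 = \<zeta> \<and> beta \<tau> G = complex_of_real (2 * Re (ell \<zeta>))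
                 \<longrightarrow> (\<forall>z\<in>unit_disc. G z = G\<^sub>\<zeta> z)))"
proof -
  interpret brfp_data n \<sigma> \<Lambda> \<tau> \<alpha>
    using assms by unfold_locales auto
  have Apos: "A > 0" using A_pos by (simp add: A_def)
  have Z_iff: "\<zeta> \<in> Z \<longleftrightarrow> 0 \<le> Re (ell \<zeta>)" if "\<zeta> \<noteq> 0" for \<zeta>
    using disc_iff_Re_ge[OF \<tau>_bd Apos that] by (simp add: Z_def ell_def)
  have zero_in: "(0::complex) \<in> unit_disc" by simp
  have G0: "Gdata a l 0 = \<zeta>" if "\<zeta> \<noteq> 0" "of_real a + l = ell \<zeta>" for a l \<zeta>
  proof -
    have "\<tau> / (of_real (a + A) + l) = \<tau> / (of_real a + l + of_real A)" by (simp add: add_ac)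
    also have "\<dots> = \<zeta>" unfolding that(2) ell_def using that(1) \<tau>_bd by auto
    finally show ?thesis by (simp add: Gdata_0 A_def)
  qed
  have extr: "\<exists>m. m \<ge> 0 \<and> beta \<tau> G = of_real (2 * m) \<and> G 0 \<noteq> 0 \<and> m \<le> Re (ell (G 0)) \<and>
     (m = Re (ell (G 0)) \<longrightarrow> (\<forall>z\<in>unit_disc. G z = Gdata m (\<i> * of_real (Im (ell (G 0)))) z))"
    if "G \<in> Gen_FL \<tau> n \<sigma> \<Lambda>" "\<not> (\<forall>z\<in>unit_disc. G z = 0)" for G
    using Gen_FL_extract[OF that] unfolding ell_def A_def by metis
  have sub: "(G 0, beta \<tau> G) \<in> {(\<zeta>, complex_of_real b) | \<zeta> b. \<zeta> \<in> Z - {0} \<and> 0 \<le> b \<and> b \<le> 2 * Re (ell \<zeta>)}"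
    if G: "G \<in> Gen_FL \<tau> n \<sigma> \<Lambda>" "\<not> (\<forall>z\<in>unit_disc. G z = 0)" for G
  proof -
    obtain m where m: "m \<ge> 0" "beta \<tau> G = of_real (2 * m)" "G 0 \<noteq> 0" "m \<le> Re (ell (G 0))"
      using extr[OF G] by blast
    then have "G 0 \<in> Z - {0}" using Z_iff[of "G 0"] by simp
    with m show ?thesis by (intro CollectI exI[of _ "G 0"] exI[of _ "2 * m"]) simp
  qed
  have sup: "\<exists>G. (\<zeta>, complex_of_real b) = (G 0, beta \<tau> G) \<and> G \<in> Gen_FL \<tau> n \<sigma> \<Lambda> \<and> \<not> (\<forall>z\<in>unit_disc. G z = 0)"
    if "\<zeta> \<in> Z - {0}" "0 \<le> b" "b \<le> 2 * Re (ell \<zeta>)" for \<zeta> b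
  proof -
    \<comment> \<open>The mass a at \<tau> gives \<beta> = b, and l is what is left of
      \<open>ell\<close>; Re l \<ge> 0 is exactly the bound on b.\<close>
    define a l where "a = b / 2" and "l = ell \<zeta> - of_real a"
    have al: "a \<ge> 0" "Re l \<ge> 0" using that by (simp_all add: a_def l_def)
    have "Gdata a l 0 = \<zeta>" using that by (intro G0) (simp_all add: l_def)
    then show ?thesis
      using Gdata_in_Gen_FL[OF al] beta_Gdata[OF al] Gdata_ne_0[OF al zero_in] zero_in
      by (intro exI[of _ "Gdata a l"]) (auto simp: a_def)
  qed
  have ext: "Gdata (Re (ell \<zeta>)) (\<i> * of_real (Im (ell \<zeta>))) \<in> Gen_FL \<tau> n \<sigma> \<Lambda> \<and>
      Gdata (Re (ell \<zeta>)) (\<i> * of_real (Im (ell \<zeta>))) 0 = \<zeta> \<and>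
      beta \<tau> (Gdata (Re (ell \<zeta>)) (\<i> * of_real (Im (ell \<zeta>)))) = complex_of_real (2 * Re (ell \<zeta>)) \<and>
      (\<forall>G\<in>Gen_FL \<tau> n \<sigma> \<Lambda>. G 0 = \<zeta> \<and> beta \<tau> G = complex_of_real (2 * Re (ell \<zeta>))
        \<longrightarrow> (\<forall>z\<in>unit_disc. G z = Gdata (Re (ell \<zeta>)) (\<i> * of_real (Im (ell \<zeta>))) z))"
    if \<zeta>: "\<zeta> \<in> Z - {0}" for \<zeta>
  proof -
    have al: "Re (ell \<zeta>) \<ge> 0" "Re (\<i> * of_real (Im (ell \<zeta>))) \<ge> 0"
      using \<zeta> Z_iff[of \<zeta>] by auto
    have "\<forall>z\<in>unit_disc. G z = Gdata (Re (ell \<zeta>)) (\<i> * of_real (Im (ell \<zeta>))) z"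
      if G: "G \<in> Gen_FL \<tau> n \<sigma> \<Lambda>" "G 0 = \<zeta>" "beta \<tau> G = complex_of_real (2 * Re (ell \<zeta>))" for G
    proof -
      \<comment> \<open>\<open>Gen_FL\<close> contains the zero generator; the value \<zeta>
        \<noteq> 0 at the origin rules it out.\<close>
      have "\<not> (\<forall>z\<in>unit_disc. G z = 0)" using G(2) \<zeta> zero_in by blast
      from extr[OF G(1) this] obtain m where
        m: "beta \<tau> G = of_real (2 * m)"
          "m = Re (ell (G 0)) \<Longrightarrow> \<forall>z\<in>unit_disc. G z = Gdata m (\<i> * of_real (Im (ell (G 0)))) z"
        by blast
      have "complex_of_real (2 * m) = of_real (2 * Re (ell \<zeta>))" using m(1) G(3) by simp
      then have "m = Re (ell \<zeta>)" by (simp only: of_real_eq_iff)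
      then show ?thesis using m(2) G(2) by simp
    qed
    moreover have "of_real (Re (ell \<zeta>)) + \<i> * of_real (Im (ell \<zeta>)) = ell \<zeta>"
      by (rule complex_eq[symmetric])
    ultimately show ?thesis
      using Gdata_in_Gen_FL[OF al] beta_Gdata[OF al] G0[of \<zeta>] \<zeta> by blast
  qed
  have Geq: "(\<lambda>z. (\<tau> - z) * (1 - cnj \<tau> * z) /
                     ((\<tau> + z) / (\<tau> - z) * complex_of_real (Re (ell \<zeta>))
                      + \<i> * complex_of_real (Im (ell \<zeta>)) + p0 n \<sigma> \<alpha> z))
      = Gdata (Re (ell \<zeta>)) (\<i> * of_real (Im (ell \<zeta>)))" for \<zeta>
    by (simp add: fun_eq_iff Gdata_def pdata_def cay_def mult.commute)
  show ?thesis
    unfolding Let_def Geq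
  proof (intro conjI[OF subset_antisym] subsetI ballI)
    fix x assume "x \<in> {(G 0, beta \<tau> G) | G. G \<in> Gen_FL \<tau> n \<sigma> \<Lambda> \<and> \<not> (\<forall>z\<in>unit_disc. G z = 0)}"
    then obtain G where "x = (G 0, beta \<tau> G)" "G \<in> Gen_FL \<tau> n \<sigma> \<Lambda>" "\<not> (\<forall>z\<in>unit_disc. G z = 0)"
      by blast
    then show "x \<in> {(\<zeta>, complex_of_real b) | \<zeta> b. \<zeta> \<in> Z - {0} \<and> 0 \<le> b \<and> b \<le> 2 * Re (ell \<zeta>)}"
      using sub by simp
  next
    fix x assume "x \<in> {(\<zeta>, complex_of_real b) | \<zeta> b. \<zeta> \<in> Z - {0} \<and> 0 \<le> b \<and> b \<le> 2 * Re (ell \<zeta>)}"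
    then obtain \<zeta> b where "x = (\<zeta>, complex_of_real b)" "\<zeta> \<in> Z - {0}" "0 \<le> b" "b \<le> 2 * Re (ell \<zeta>)"
      by blast
    then show "x \<in> {(G 0, beta \<tau> G) | G. G \<in> Gen_FL \<tau> n \<sigma> \<Lambda> \<and> \<not> (\<forall>z\<in>unit_disc. G z = 0)}"
      using sup by (intro CollectI) blast
  qed (rule ext)
qed

end
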